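(* Let $p$ be a prime, $n\ge1$, $m\ge1$, and let $G\subseteq\mathrm{GL}_n(\mathbb F_p)$ be a subgroup fixing a hyperplane $H\subset V=(\mathbb F_p)^n$ pointwise, with maximal transvection root space, i.e. $\dim_{\mathbb F_p}(\mathrm{RootSpace}(G)\cap H)=n-1$. Let $e$ be the maximal order of a semisimple element of $G$. Then $$\mathrm{Hilb}\Big(\big(S/\mathfrak m^{[p^m]}\big)^G,t\Big)=\Big(\frac{1-t^{p^m}}{1-t^p}\Big)^{n-1}\frac{1-t^{p^m-1}}{1-t^e}+t^{p^m-1}\Big(\frac{1-t^{p^m}}{1-t}\Big)^{n-1}.$$
   Context: $S=\mathbb F_p[x_1,\dots,x_n]$ is the symmetric algebra of $V^*$ (graded by degree), with $G$ acting by linear substitution; $\mathfrak m^{[p^m]}=(x_1^{p^m},\dots,x_n^{p^m})$. $\mathrm{Hilb}(M,t)=\sum_d\dim M_d\,t^d$. Root space: fix $l\in V^*$ with $\ker l=H$; each $g\in G$ determines $\alpha_g\in V$ with $g(v)=v+l(v)\alpha_g$, and $\mathrm{RootSpace}(G)=\{\alpha_g:g\in G\}$. $e$ is the index in $G$ of the subgroup of transvections (kernel of $\det|_G$), $e=1$ if there are no nontrivial semisimple elements. *)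

theory Defs
  imports
    "HOL-Analysis.Analysis"
    "HOL-Library.Poly_Mapping"
    "HOL-Computational_Algebra.Formal_Power_Series"
    "HOL-Algebra.Multiplicative_Group"
    "HOL-Algebra.QuotRing"
    "HOL-Algebra.Embedded_Algebras"
    "HOL-Algebra.Algebraic_Closure_Type"
    "Berlekamp_Zassenhaus.Finite_Field"
begin

definition GL :: "('a::field ^ 'n ^ 'n) monoid" where
  "GL = \<lparr>carrier = {A. invertible A}, monoid.mult = (**), one = mat 1\<rparr>"

text \<open>Semisimplicity of a linear operator: every invariant subspace has an invariant complement.\<close>

definition semisimple :: "'a::field ^ 'n ^ 'n \<Rightarrow> bool" where
  "semisimple A \<longleftrightarrow>
     (\<forall>U. vec.subspace U \<and> (\<forall>u\<in>U. A *v u \<in> U) \<longrightarrow>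
       (\<exists>W. vec.subspace W \<and> (\<forall>w\<in>W. A *v w \<in> W) \<and>
            U \<inter> W = {0} \<and> (\<forall>v. \<exists>u\<in>U. \<exists>w\<in>W. v = u + w)))"

definition root_space ::
  "('a::field ^ 'n \<Rightarrow> 'a) \<Rightarrow> ('a ^ 'n ^ 'n) set \<Rightarrow> ('a ^ 'n) set" where
  "root_space l G = {\<alpha>. \<exists>g\<in>G. \<forall>v. g *v v = v + l v *s \<alpha>}"

text \<open>Polynomials over \<open>'a\<close> in the variables \<open>x\<^sub>i\<close>, \<open>i :: 'n\<close>: a monomial is its
  exponent vector \<open>'n \<Rightarrow>\<^sub>0 nat\<close>, and multiplication is the convolution product.\<close>

type_synonym ('n, 'a) mpoly = "('n \<Rightarrow>\<^sub>0 nat) \<Rightarrow>\<^sub>0 'a"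

definition Const :: "'a::zero \<Rightarrow> ('n, 'a) mpoly" where
  "Const c = Poly_Mapping.single 0 c"

definition Var :: "'n \<Rightarrow> ('n, 'a::zero_neq_one) mpoly" where
  "Var i = Poly_Mapping.single (Poly_Mapping.single i 1) 1"

definition homogeneous :: "nat \<Rightarrow> ('n::finite, 'a::zero) mpoly set" where
  "homogeneous d = {f. \<forall>\<mu>\<in>Poly_Mapping.keys f. (\<Sum>i\<in>UNIV. Poly_Mapping.lookup \<mu> i) = d}"

text \<open>The action on polynomial functions on \<open>'a ^ 'n\<close> is \<open>(g f)(v) = f (g\<inverse> v)\<close>, i.e.\ the
  variable \<open>x\<^sub>i\<close> (the \<open>i\<close>-th coordinate function) is replaced by the
  \<open>i\<close>-th coordinate of \<open>g\<inverse> v\<close>.\<close>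

definition act :: "'a::field ^ 'n ^ 'n \<Rightarrow> ('n::finite, 'a) mpoly \<Rightarrow> ('n, 'a) mpoly" where
  "act g f = (\<Sum>\<mu>\<in>Poly_Mapping.keys f. Const (Poly_Mapping.lookup f \<mu>) *
     (\<Prod>i\<in>UNIV. (\<Sum>j\<in>UNIV. Const (matrix_inv g $ i $ j) * Var j) ^ Poly_Mapping.lookup \<mu> i))"

abbreviation poly_ring :: "('n, 'a::field) mpoly ring" where
  "poly_ring \<equiv> ring_of_type_algebra"

definition power_ideal :: "nat \<Rightarrow> ('n, 'a::field) mpoly set" where
  "power_ideal q = Idl\<^bsub>poly_ring\<^esub> (range (\<lambda>i. Var i ^ q))"

abbreviation quot_ring :: "nat \<Rightarrow> ('n, 'a::field) mpoly set ring" where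
  "quot_ring q \<equiv> poly_ring Quot power_ideal q"

abbreviation residue_class :: "nat \<Rightarrow> ('n, 'a::field) mpoly \<Rightarrow> ('n, 'a) mpoly set" where
  "residue_class q f \<equiv> power_ideal q +>\<^bsub>poly_ring\<^esub> f"

text \<open>A group element \<open>g\<close> acts on a residue class by taking images, since
  \<open>g (f + I) = g f + I\<close> for the \<open>g\<close>-stable ideals \<open>I\<close> considered here
  (\<open>q\<close> a power of the characteristic).\<close>

definition quot_invariants ::
  "nat \<Rightarrow> ('a::field ^ 'n ^ 'n) set \<Rightarrow> ('n::finite, 'a) mpoly set set" where
  "quot_invariants q G = {C \<in> carrier (quot_ring q). \<forall>g\<in>G. act g ` C = C}"

definition quot_degree :: "nat \<Rightarrow> nat \<Rightarrow> ('n::finite, 'a::field) mpoly set set" where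
  "quot_degree q d = residue_class q ` homogeneous d"

text \<open>Dimensions are taken over the field of constants, embedded in the quotient ring.\<close>

definition hilb :: "nat \<Rightarrow> ('n::finite, 'a::field) mpoly set set \<Rightarrow> rat fps" where
  "hilb q M = Abs_fps (\<lambda>d. of_nat
     (ring.dim (quot_ring q) (range (\<lambda>c. residue_class q (Const c))) (M \<inter> quot_degree q d)))"

end

theory Submission
  imports Defs
begin

text \<open>
  Choose coordinates in which \<open>y = l\<close> is one of the variables. An element of \<open>G\<close> with root \<open>\<alpha>\<close>
  sends \<open>y\<close> to \<open>(1 + l \<alpha>) y\<close> and every other variable \<open>x\<^sub>i\<close> to \<open>x\<^sub>i + \<alpha>\<^sub>i y\<close>. Since the root space is
  closed under addition of roots in \<open>H\<close> and the field is prime, \<open>G\<close> contains all transvections along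
  \<open>H\<close>; the eigenvalues \<open>1 + l \<alpha>\<close> form the cyclic group of order \<open>e\<close>. The orbit products
  \<open>f\<^sub>i = x\<^sub>i\<^sup>p - x\<^sub>i y\<^bsup>p-1\<^esup>\<close> are \<open>G\<close>-invariant, and the products of \<open>y\<^sup>b\<close> with the \<open>f\<^sub>i\<^sup>a x\<^sub>i\<^sup>r\<close>, where
  \<open>r < p\<close>, \<open>p a + r < q = p\<^sup>m\<close> and \<open>b < q\<close>, form a basis of the quotient because they agree with
  monomials up to higher powers of \<open>y\<close>. In this basis the transvection \<open>x\<^sub>i \<mapsto> x\<^sub>i + y\<close> only expands
  \<open>(x\<^sub>i + y)\<^sup>r\<close>; comparing coefficients, in order of increasing power of \<open>y\<close>, shows that an invariant
  involves only basis elements with all \<open>r = 0\<close> or with \<open>b = q - 1\<close>. The diagonal elements add the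
  condition \<open>e dvd b\<close>, and counting the remaining basis elements by degree gives the two summands.
\<close>

section \<open>Constants, variables and monomials of the polynomial ring\<close>

lemma type_ring_simps [simp]:
  "carrier (ring_of_type_algebra :: 'a::ring_1 ring) = UNIV"
  "x \<oplus>\<^bsub>ring_of_type_algebra\<^esub> y = x + y"
  "x \<otimes>\<^bsub>ring_of_type_algebra\<^esub> y = x * y"
  "\<zero>\<^bsub>ring_of_type_algebra\<^esub> = 0"
  "\<one>\<^bsub>ring_of_type_algebra\<^esub> = 1"
  by (simp_all add: ring_of_type_algebra_def)

lemma Const_simps [simp]:
  "Const 0 = 0" "Const 1 = 1"
  by (simp_all add: Const_def)

lemma Const_add: "Const (a + b) = Const a + Const b"
  by (simp add: Const_def single_add)

lemma Const_uminus: "Const (- a) = - Const a"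
  by (simp add: Const_def single_uminus)

lemma Const_diff: "Const (a - b) = Const a - Const b"
  by (simp add: Const_def single_diff)

lemma Const_mult: "Const (a * b) = Const a * Const b"
  by (simp add: Const_def mult_single)

lemma Const_power: "Const (a ^ k) = Const a ^ k"
  by (induction k) (simp_all add: Const_mult)

lemma Const_of_nat: "Const (of_nat k) = of_nat k"
  by (induction k) (simp_all add: Const_add)

lemma Const_sum: "Const (sum f A) = (\<Sum>a\<in>A. Const (f a))"
  by (induction A rule: infinite_finite_induct) (simp_all add: Const_add)

lemma lookup_Const_mult:
  "Poly_Mapping.lookup (Const c * f) \<mu> = c * Poly_Mapping.lookup f \<mu>"
  unfolding Const_def mult_map_scale_conv_mult[symmetric]
  by (simp add: Poly_Mapping.map.rep_eq when_def)

lemma poly_mapping_eq_sum_single: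
  "f = (\<Sum>\<mu>\<in>Poly_Mapping.keys f. Poly_Mapping.single \<mu> (Poly_Mapping.lookup f \<mu>))"
proof (rule poly_mapping_eqI)
  fix \<nu>
  show "Poly_Mapping.lookup f \<nu> = Poly_Mapping.lookup
    (\<Sum>\<mu>\<in>Poly_Mapping.keys f. Poly_Mapping.single \<mu> (Poly_Mapping.lookup f \<mu>)) \<nu>"
    by (simp add: lookup_sum lookup_single when_def in_keys_iff)
qed

lemma single_sum: "Poly_Mapping.single (sum g A) 1 = (\<Prod>a\<in>A. Poly_Mapping.single (g a) (1::'a::comm_semiring_1))"
  for g :: "_ \<Rightarrow> 'b::comm_monoid_add"
proof (induction A rule: infinite_finite_induct)
  case (insert x F)
  then show ?case
    using mult_single[of "g x" "1::'a" "sum g F" 1] by simp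
qed simp_all

lemma Var_power: "Var i ^ k = Poly_Mapping.single (Poly_Mapping.single i k) (1::'a::comm_semiring_1)"
  by (induction k) (simp_all add: Var_def mult_single single_add[symmetric])

lemma prod_Var_power:
  fixes \<mu> :: "'n::finite \<Rightarrow>\<^sub>0 nat"
  shows "(\<Prod>i\<in>UNIV. Var i ^ Poly_Mapping.lookup \<mu> i) = Poly_Mapping.single \<mu> (1::'a::comm_semiring_1)"
proof -
  have "\<mu> = (\<Sum>i\<in>UNIV. Poly_Mapping.single i (Poly_Mapping.lookup \<mu> i))"
    by (rule poly_mapping_eqI) (simp add: lookup_sum lookup_single when_def)
  then show ?thesis
    by (simp add: Var_power flip: single_sum)
qed

lemma single_eq_Const_times_Vars:
  fixes \<mu> :: "'n::finite \<Rightarrow>\<^sub>0 nat"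
  shows "Poly_Mapping.single \<mu> (c::'a::comm_semiring_1) = Const c * (\<Prod>i\<in>UNIV. Var i ^ Poly_Mapping.lookup \<mu> i)"
  by (simp add: prod_Var_power Const_def mult_single)

lemma mpoly_induct [case_names add single]:
  fixes f :: "('n, 'a::comm_monoid_add) mpoly"
  assumes "\<And>f g. P f \<Longrightarrow> P g \<Longrightarrow> P (f + g)" "\<And>\<mu> c. P (Poly_Mapping.single \<mu> c)"
  shows "P f"
proof -
  \<comment> \<open>The empty sum is covered by the single term with coefficient 0, so no separate
    case for the zero polynomial arises.\<close>
  have "P (\<Sum>\<mu>\<in>A. Poly_Mapping.single \<mu> (Poly_Mapping.lookup f \<mu>))" if "finite A" for A
    using that assms(2)[of 0 0] by (induction A) (simp_all add: assms)
  then show ?thesis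
    by (metis poly_mapping_eq_sum_single finite_keys)
qed

section \<open>Algebra homomorphisms\<close>

text \<open>Fixing the constants gives linearity over them and includes \<open>1 = Const 1\<close>;
  such a map is determined by the images of the variables (\<open>alg_hom_eqI\<close>).\<close>

definition alg_hom :: "(('n, 'a::comm_ring_1) mpoly \<Rightarrow> ('n, 'a) mpoly) \<Rightarrow> bool" where
  "alg_hom \<phi> \<longleftrightarrow> (\<forall>f g. \<phi> (f + g) = \<phi> f + \<phi> g) \<and> (\<forall>f g. \<phi> (f * g) = \<phi> f * \<phi> g) \<and>
    (\<forall>c. \<phi> (Const c) = Const c)"

lemma alg_hom_add: "alg_hom \<phi> \<Longrightarrow> \<phi> (f + g) = \<phi> f + \<phi> g"
  and alg_hom_mult: "alg_hom \<phi> \<Longrightarrow> \<phi> (f * g) = \<phi> f * \<phi> g"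
  and alg_hom_Const: "alg_hom \<phi> \<Longrightarrow> \<phi> (Const c) = Const c"
  unfolding alg_hom_def by blast+

lemma alg_hom_0: "alg_hom \<phi> \<Longrightarrow> \<phi> 0 = 0"
  and alg_hom_1: "alg_hom \<phi> \<Longrightarrow> \<phi> 1 = 1"
  using alg_hom_Const[of \<phi> 0] alg_hom_Const[of \<phi> 1] by simp_all

lemma alg_hom_uminus: "alg_hom \<phi> \<Longrightarrow> \<phi> (- f) = - \<phi> f"
  using alg_hom_add[of \<phi> f "- f"] by (simp add: alg_hom_0 eq_neg_iff_add_eq_0 add.commute)

lemma alg_hom_diff: "alg_hom \<phi> \<Longrightarrow> \<phi> (f - g) = \<phi> f - \<phi> g"
  using alg_hom_add[of \<phi> f "- g"] by (simp add: alg_hom_uminus)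

lemma alg_hom_power: "alg_hom \<phi> \<Longrightarrow> \<phi> (f ^ k) = \<phi> f ^ k"
  by (induction k) (simp_all add: alg_hom_1 alg_hom_mult)

lemma alg_hom_sum: "alg_hom \<phi> \<Longrightarrow> \<phi> (sum f A) = (\<Sum>a\<in>A. \<phi> (f a))"
  by (induction A rule: infinite_finite_induct) (simp_all add: alg_hom_0 alg_hom_add)

lemma alg_hom_prod: "alg_hom \<phi> \<Longrightarrow> \<phi> (prod f A) = (\<Prod>a\<in>A. \<phi> (f a))"
  by (induction A rule: infinite_finite_induct) (simp_all add: alg_hom_1 alg_hom_mult)

lemmas alg_hom_simps = alg_hom_add alg_hom_mult alg_hom_Const alg_hom_0 alg_hom_1 alg_hom_uminus
  alg_hom_diff alg_hom_power alg_hom_sum alg_hom_prod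

lemma alg_hom_comp: "alg_hom \<phi> \<Longrightarrow> alg_hom \<psi> \<Longrightarrow> alg_hom (\<lambda>f. \<phi> (\<psi> f))"
  by (simp add: alg_hom_def)

lemma alg_hom_id: "alg_hom (\<lambda>f. f)"
  by (simp add: alg_hom_def)

lemma alg_hom_eqI:
  fixes \<phi> :: "('n::finite, 'a::comm_ring_1) mpoly \<Rightarrow> ('n, 'a) mpoly"
  assumes "alg_hom \<phi>" "alg_hom \<psi>" "\<And>i. \<phi> (Var i) = \<psi> (Var i)"
  shows "\<phi> f = \<psi> f"
proof (induction f rule: mpoly_induct)
  case (add f g)
  then show ?case using assms by (simp add: alg_hom_add)
next
  case (single \<mu> c)
  then show ?case using assms by (simp add: single_eq_Const_times_Vars alg_hom_simps)
qed

text \<open>The common shape of the group action and of all coordinate changes below; each of them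
  is an algebra homomorphism because \<open>subst L\<close> is one.\<close>

definition subst :: "('n::finite \<Rightarrow> ('n, 'a::comm_ring_1) mpoly) \<Rightarrow> ('n, 'a) mpoly \<Rightarrow> ('n, 'a) mpoly" where
  "subst L f = (\<Sum>\<mu>\<in>Poly_Mapping.keys f. Const (Poly_Mapping.lookup f \<mu>) *
     (\<Prod>i\<in>UNIV. L i ^ Poly_Mapping.lookup \<mu> i))"

text \<open>Cancellation can shrink the set of keys of a sum. Summing over a fixed larger set, with
  zero coefficients for the missing monomials, makes additivity visible.\<close>

lemma subst_eq_sum:
  assumes "finite A" "Poly_Mapping.keys f \<subseteq> A"
  shows "subst L f = (\<Sum>\<mu>\<in>A. Const (Poly_Mapping.lookup f \<mu>) * (\<Prod>i\<in>UNIV. L i ^ Poly_Mapping.lookup \<mu> i))"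
  unfolding subst_def using assms by (intro sum.mono_neutral_left) (auto simp: in_keys_iff)

lemma subst_add: "subst L (f + g) = subst L f + subst L g"
proof -
  let ?A = "Poly_Mapping.keys f \<union> Poly_Mapping.keys g"
  have "Poly_Mapping.keys (f + g) \<subseteq> ?A" by (rule Poly_Mapping.keys_add)
  then show ?thesis
    by (simp add: subst_eq_sum[of ?A] lookup_add Const_add algebra_simps sum.distrib)
qed

lemma subst_single:
  "subst L (Poly_Mapping.single \<mu> c) = Const c * (\<Prod>i\<in>UNIV. L i ^ Poly_Mapping.lookup \<mu> i)"
  by (simp add: subst_eq_sum[of "{\<mu>}"])

lemma subst_mult: "subst L (f * g) = subst L f * subst L g"
proof (induction f rule: mpoly_induct)
  case (add f f')
  then show ?case by (simp add: subst_add distrib_right)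
next
  case (single \<mu> c)
  show ?case
  proof (induction g rule: mpoly_induct)
    case (add g g')
    then show ?case by (simp add: subst_add distrib_left)
  next
    case (single \<nu> d)
    then show ?case
      by (simp add: mult_single subst_single lookup_add power_add prod.distrib Const_mult algebra_simps)
  qed
qed

lemma alg_hom_subst: "alg_hom (subst L)"
  unfolding alg_hom_def by (auto simp: subst_add subst_mult subst_single Const_def)

lemma subst_Var: "subst L (Var i) = L i"
proof -
  have "(\<Prod>j\<in>UNIV. L j ^ (if i = j then 1 else 0)) = (\<Prod>j\<in>UNIV. if i = j then L j else 1)"
    by (rule prod.cong) auto
  then show ?thesis by (simp add: Var_def subst_single lookup_single when_def One_nat_def[symmetric] del: One_nat_def)
qed

lemma act_eq_subst: "act g = subst (\<lambda>i. \<Sum>j\<in>UNIV. Const (matrix_inv g $ i $ j) * Var j)"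
  by (rule ext) (simp add: act_def subst_def)

lemma alg_hom_act: "alg_hom (act g)"
  by (simp add: act_eq_subst alg_hom_subst)

section \<open>Homogeneous polynomials\<close>

lemma homogeneous_0: "0 \<in> homogeneous d"
  by (simp add: homogeneous_def)

lemma homogeneous_add: "f \<in> homogeneous d \<Longrightarrow> g \<in> homogeneous d \<Longrightarrow> f + g \<in> homogeneous d"
  using Poly_Mapping.keys_add[of f g] by (auto simp: homogeneous_def)

lemma homogeneous_mult:
  "f \<in> homogeneous c \<Longrightarrow> g \<in> homogeneous d \<Longrightarrow> f * g \<in> homogeneous (c + d)"
  using keys_mult[of f g] by (fastforce simp: homogeneous_def lookup_add sum.distrib)

lemma homogeneous_Const: "Const c \<in> homogeneous 0"
  by (simp add: homogeneous_def Const_def)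

lemma homogeneous_1: "1 \<in> homogeneous 0"
  by (simp add: homogeneous_def)

lemma homogeneous_Const_mult: "f \<in> homogeneous d \<Longrightarrow> Const c * f \<in> homogeneous d"
  using homogeneous_mult[OF homogeneous_Const] by force

lemma homogeneous_diff:
  "f \<in> homogeneous d \<Longrightarrow> g \<in> homogeneous d \<Longrightarrow> f - g \<in> homogeneous d" for f :: "('n::finite, 'a::comm_ring_1) mpoly"
  using homogeneous_add[of f d "Const (-1) * g"] homogeneous_Const_mult[of g d "-1"]
  by (simp add: Const_uminus)

lemma homogeneous_Var: "Var i \<in> homogeneous 1"
  by (simp add: homogeneous_def Var_def lookup_single when_def)

lemma homogeneous_sum: "(\<And>a. a \<in> A \<Longrightarrow> f a \<in> homogeneous d) \<Longrightarrow> sum f A \<in> homogeneous d"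
  by (induction A rule: infinite_finite_induct) (simp_all add: homogeneous_0 homogeneous_add)

lemma homogeneous_power: "f \<in> homogeneous d \<Longrightarrow> f ^ k \<in> homogeneous (d * k)" for f :: "('n::finite, 'a::comm_ring_1) mpoly"
  by (induction k) (simp_all add: homogeneous_1 homogeneous_mult)

lemma homogeneous_prod:
  fixes f :: "'b \<Rightarrow> ('n::finite, 'a::comm_ring_1) mpoly"
  shows "(\<And>a. a \<in> A \<Longrightarrow> f a \<in> homogeneous (d a)) \<Longrightarrow> prod f A \<in> homogeneous (sum d A)"
  by (induction A rule: infinite_finite_induct) (simp_all add: homogeneous_1 homogeneous_mult)

text \<open>A monomial of degree d becomes a product of d linear forms, counted with
  multiplicity.\<close>

lemma homogeneous_alg_hom:
  fixes f :: "('n::finite, 'a::comm_ring_1) mpoly"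
  assumes "alg_hom \<phi>" "\<And>i. \<phi> (Var i) \<in> homogeneous 1" "f \<in> homogeneous d"
  shows "\<phi> f \<in> homogeneous d"
proof -
  have "\<phi> f = (\<Sum>\<mu>\<in>Poly_Mapping.keys f. Const (Poly_Mapping.lookup f \<mu>) *
      (\<Prod>i\<in>UNIV. \<phi> (Var i) ^ Poly_Mapping.lookup \<mu> i))"
    by (subst poly_mapping_eq_sum_single) (simp add: single_eq_Const_times_Vars alg_hom_simps assms(1))
  also have "\<dots> \<in> homogeneous d"
  proof (intro homogeneous_sum homogeneous_Const_mult)
    fix \<mu> assume "\<mu> \<in> Poly_Mapping.keys f"
    \<comment> \<open>The factor 1 is the degree of each linear form; it gives the sum the shape
      produced by \<open>homogeneous_power\<close>.\<close>
    with assms(3) have "d = (\<Sum>i\<in>UNIV. 1 * Poly_Mapping.lookup \<mu> i)"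
      by (simp add: homogeneous_def)
    then show "(\<Prod>i\<in>UNIV. \<phi> (Var i) ^ Poly_Mapping.lookup \<mu> i) \<in> homogeneous d"
      using assms(2) by (simp only:) (intro homogeneous_prod homogeneous_power, simp)
  qed
  finally show ?thesis .
qed

section \<open>The ideal of powers\<close>

text \<open>Multiplying monomials only raises exponents, so a condition of the form "some exponent
  is at least q" on all keys survives multiplication. This ideal bounds \<open>power_ideal q\<close>
  from above.\<close>

lemma ideal_monomials_exceeding:
  "ideal {f :: ('n, 'a::field) mpoly. \<forall>\<mu>\<in>Poly_Mapping.keys f. \<exists>i. q \<le> Poly_Mapping.lookup \<mu> i} poly_ring"
    (is "ideal ?J _")
proof -
  interpret R: cring "poly_ring :: ('n, 'a) mpoly ring" by (rule cring_from_type_algebra)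
  have add: "f + g \<in> ?J" if "f \<in> ?J" "g \<in> ?J" for f g
    using Poly_Mapping.keys_add[of f g] that by auto
  have mult: "h * f \<in> ?J" if "f \<in> ?J" for f h
  proof (clarify)
    fix \<mu> assume "\<mu> \<in> Poly_Mapping.keys (h * f)"
    then obtain a b where "\<mu> = a + b" "b \<in> Poly_Mapping.keys f" using keys_mult[of h f] by blast
    with that obtain i where "q \<le> Poly_Mapping.lookup b i" by blast
    with \<open>\<mu> = a + b\<close> show "\<exists>i. q \<le> Poly_Mapping.lookup \<mu> i"
      by (intro exI[of _ i]) (simp add: lookup_add)
  qed
  have inv: "\<ominus>\<^bsub>poly_ring\<^esub> f = - f" for f :: "('n, 'a) mpoly"
    using R.minus_equality[of "-f" f] by simp
  show ?thesis
  proof (rule idealI)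
    show "ring (poly_ring :: ('n, 'a) mpoly ring)" ..
    show "subgroup ?J (add_monoid poly_ring)"
    proof (rule R.add.subgroupI)
      show "?J \<noteq> {}" by (rule ex_in_conv[THEN iffD1]) (rule exI[of _ 0], simp)
      show "\<ominus>\<^bsub>poly_ring\<^esub> f \<in> ?J" if "f \<in> ?J" for f
        using that by (simp add: inv)
      show "f \<oplus>\<^bsub>poly_ring\<^esub> g \<in> ?J" if "f \<in> ?J" "g \<in> ?J" for f g
        using add[OF that] by simp
    qed simp
    show "x \<otimes>\<^bsub>poly_ring\<^esub> a \<in> ?J" if "a \<in> ?J" for a x
      using mult[OF that] by simp
    show "a \<otimes>\<^bsub>poly_ring\<^esub> x \<in> ?J" if "a \<in> ?J" for a x
      using mult[OF that, of x] by (simp add: mult.commute)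
  qed
qed

lemma ideal_power_ideal: "ideal (power_ideal q :: ('n, 'a::field) mpoly set) poly_ring"
  unfolding power_ideal_def
  by (rule ring.genideal_ideal[OF ring_from_type_algebra]) simp

lemma power_ideal_add: "f \<in> power_ideal q \<Longrightarrow> g \<in> power_ideal q \<Longrightarrow> f + g \<in> power_ideal q"
  using additive_subgroup.a_closed[OF ideal.axioms(1)[OF ideal_power_ideal]] by force

lemma power_ideal_0: "0 \<in> power_ideal q"
  using additive_subgroup.zero_closed[OF ideal.axioms(1)[OF ideal_power_ideal]] by force

lemma power_ideal_mult: "f \<in> power_ideal q \<Longrightarrow> h * f \<in> power_ideal q"
  using ideal.I_l_closed[OF ideal_power_ideal] by force

lemma power_ideal_uminus: "f \<in> power_ideal q \<Longrightarrow> - f \<in> power_ideal q"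
  using power_ideal_mult[of f q "-1"] by simp

lemma power_ideal_diff: "f \<in> power_ideal q \<Longrightarrow> g \<in> power_ideal q \<Longrightarrow> f - g \<in> power_ideal q"
  using power_ideal_add[of f q "-g"] power_ideal_uminus by auto

lemma power_ideal_diff_trans:
  "f - g \<in> power_ideal q \<Longrightarrow> g - h \<in> power_ideal q \<Longrightarrow> f - h \<in> power_ideal q"
  using power_ideal_add[of "f - g" q "g - h"] by simp

lemma power_ideal_diff_commute: "f - g \<in> power_ideal q \<longleftrightarrow> g - f \<in> power_ideal q"
  using power_ideal_uminus[of "f - g" q] power_ideal_uminus[of "g - f" q] by auto

lemma power_ideal_sum: "(\<And>a. a \<in> A \<Longrightarrow> f a \<in> power_ideal q) \<Longrightarrow> sum f A \<in> power_ideal q"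
  by (induction A rule: infinite_finite_induct) (simp_all add: power_ideal_0 power_ideal_add)

lemma Var_power_in_power_ideal: "Var i ^ q \<in> power_ideal q"
  unfolding power_ideal_def
  by (rule ring.genideal_self[OF ring_from_type_algebra, THEN subsetD]) auto

lemma Var_power_dvd_in_power_ideal: "Var i ^ q dvd f \<Longrightarrow> f \<in> power_ideal q"
  by (metis dvdE mult.commute power_ideal_mult Var_power_in_power_ideal)

text \<open>The ideal is generated by monomials, so membership is decided term by term. Minimality
  of the generated ideal gives one direction; splitting f into its terms, each divisible by some
  \<open>Var i ^ q\<close>, gives the other.\<close>

lemma in_power_ideal_iff:
  fixes f :: "('n::finite, 'a::field) mpoly"
  shows "f \<in> power_ideal q \<longleftrightarrow> (\<forall>\<mu>\<in>Poly_Mapping.keys f. \<exists>i. q \<le> Poly_Mapping.lookup \<mu> i)"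
proof
  assume "f \<in> power_ideal q"
  moreover have "power_ideal q \<subseteq>
      {f :: ('n, 'a) mpoly. \<forall>\<mu>\<in>Poly_Mapping.keys f. \<exists>i. q \<le> Poly_Mapping.lookup \<mu> i}"
    unfolding power_ideal_def
    by (rule ring.genideal_minimal[OF ring_from_type_algebra ideal_monomials_exceeding])
       (auto simp: Var_power, metis lookup_single_eq order_refl)
  ultimately show "\<forall>\<mu>\<in>Poly_Mapping.keys f. \<exists>i. q \<le> Poly_Mapping.lookup \<mu> i" by blast
next
  assume *: "\<forall>\<mu>\<in>Poly_Mapping.keys f. \<exists>i. q \<le> Poly_Mapping.lookup \<mu> i"
  show "f \<in> power_ideal q"
  proof (subst poly_mapping_eq_sum_single, rule power_ideal_sum)
    fix \<mu> assume "\<mu> \<in> Poly_Mapping.keys f"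
    with * obtain i where i: "q \<le> Poly_Mapping.lookup \<mu> i" by blast
    have "Var i ^ q dvd (Var i ^ Poly_Mapping.lookup \<mu> i :: ('n, 'a) mpoly)"
      using i by (rule le_imp_power_dvd)
    also have "\<dots> dvd (\<Prod>i\<in>UNIV. Var i ^ Poly_Mapping.lookup \<mu> i)"
      by (rule dvd_prodI) auto
    finally show "Poly_Mapping.single \<mu> (Poly_Mapping.lookup f \<mu>) \<in> power_ideal q"
      unfolding single_eq_Const_times_Vars
      by (intro Var_power_dvd_in_power_ideal dvd_mult)
  qed
qed

text \<open>Each term of f has an exponent at least q at some i, so its image is a multiple of
  \<open>\<phi> (Var i) ^ q\<close>.\<close>

lemma power_ideal_alg_hom:
  fixes f :: "('n::finite, 'a::field) mpoly"
  assumes "alg_hom \<phi>" "\<And>i. \<phi> (Var i) ^ q \<in> power_ideal q" "f \<in> power_ideal q"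
  shows "\<phi> f \<in> power_ideal q"
proof -
  have "\<phi> f = (\<Sum>\<mu>\<in>Poly_Mapping.keys f. Const (Poly_Mapping.lookup f \<mu>) *
      (\<Prod>i\<in>UNIV. \<phi> (Var i) ^ Poly_Mapping.lookup \<mu> i))"
    by (subst poly_mapping_eq_sum_single) (simp add: single_eq_Const_times_Vars alg_hom_simps assms(1))
  also have "\<dots> \<in> power_ideal q"
  proof (intro power_ideal_sum power_ideal_mult)
    fix \<mu> assume "\<mu> \<in> Poly_Mapping.keys f"
    with assms(3) obtain i where i: "q \<le> Poly_Mapping.lookup \<mu> i"
      by (auto simp: in_power_ideal_iff)
    have "\<phi> (Var i) ^ q dvd \<phi> (Var i) ^ Poly_Mapping.lookup \<mu> i"
      using i by (rule le_imp_power_dvd)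
    also have "\<dots> dvd (\<Prod>i\<in>UNIV. \<phi> (Var i) ^ Poly_Mapping.lookup \<mu> i)"
      by (rule dvd_prodI) auto
    finally show "(\<Prod>i\<in>UNIV. \<phi> (Var i) ^ Poly_Mapping.lookup \<mu> i) \<in> power_ideal q"
      by (metis dvdE mult.commute power_ideal_mult assms(2))
  qed
  finally show ?thesis .
qed

section \<open>The quotient ring\<close>

lemma in_residue_class_iff:
  fixes f :: "('n, 'a::field) mpoly"
  shows "x \<in> residue_class q f \<longleftrightarrow> x - f \<in> power_ideal q"
  unfolding a_r_coset_def' by (auto intro: bexI[of _ "x - f"])

lemma residue_class_eq_iff:
  "residue_class q f = residue_class q g \<longleftrightarrow> f - g \<in> power_ideal q"
proof
  assume "residue_class q f = residue_class q g"
  then have "f \<in> residue_class q g"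
    using in_residue_class_iff[of f q f] power_ideal_0 by auto
  then show "f - g \<in> power_ideal q" by (simp add: in_residue_class_iff)
next
  assume "f - g \<in> power_ideal q"
  then show "residue_class q f = residue_class q g"
    by (auto simp: in_residue_class_iff intro: power_ideal_diff_trans)
       (metis power_ideal_diff_commute power_ideal_diff_trans)
qed

lemma carrier_quot_ring: "carrier (quot_ring q) = range (residue_class q)"
  by (auto simp: FactRing_def A_RCOSETS_def')

lemma residue_class_ring_hom:
  "residue_class q \<in> Ring.ring_hom poly_ring (quot_ring q :: ('n, 'a::field) mpoly set ring)"
  by (rule ideal.rcos_ring_hom[OF ideal_power_ideal])

lemma residue_class_add:
  "residue_class q (f + g) = residue_class q f \<oplus>\<^bsub>quot_ring q\<^esub> residue_class q g"
  using Ring.ring_hom_add[OF residue_class_ring_hom] by force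

lemma residue_class_mult:
  "residue_class q (f * g) = residue_class q f \<otimes>\<^bsub>quot_ring q\<^esub> residue_class q g"
  using Ring.ring_hom_mult[OF residue_class_ring_hom] by force

lemma residue_class_0: "residue_class q 0 = \<zero>\<^bsub>quot_ring q\<^esub>"
  using Ring.ring_hom_zero[OF residue_class_ring_hom ring_from_type_algebra ideal.quotient_is_ring[OF ideal_power_ideal]]
  by simp

lemma residue_class_1: "residue_class q 1 = \<one>\<^bsub>quot_ring q\<^esub>"
  using Ring.ring_hom_one[OF residue_class_ring_hom] by simp

text \<open>For positive q the ideal does not contain 1, so the field of constants embeds in the
  quotient and dimensions over it make sense.\<close>

lemma subfield_constants:
  assumes "q > 0"
  shows "subfield (range (\<lambda>c. residue_class q (Const c))) (quot_ring q :: ('n::finite, 'a::field) mpoly set ring)"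
proof -
  let ?F = "ring_of_type_algebra :: 'a ring"
  let ?Q = "quot_ring q :: ('n, 'a) mpoly set ring"
  let ?h = "\<lambda>c. residue_class q (Const c :: ('n, 'a) mpoly)"
  interpret F: field ?F by (rule field_from_type_algebra)
  interpret Q: ring ?Q by (rule ideal.quotient_is_ring[OF ideal_power_ideal])
  interpret h: ring_hom_ring ?F ?Q ?h
  proof (rule ring_hom_ringI)
    show "?h x \<in> carrier ?Q" for x by (simp add: carrier_quot_ring)
  qed (simp_all add: residue_class_add residue_class_mult residue_class_1 Const_add Const_mult F.ring_axioms Q.ring_axioms)
  have "(1 :: ('n, 'a) mpoly) \<notin> power_ideal q"
    using assms by (simp add: in_power_ideal_iff)
  then have "\<one>\<^bsub>?Q\<^esub> \<noteq> \<zero>\<^bsub>?Q\<^esub>"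
    unfolding residue_class_1[symmetric] residue_class_0[symmetric] residue_class_eq_iff by simp
  from h.img_is_subfield(2)[OF F.carrier_is_subfield this] show ?thesis by simp
qed

text \<open>Adding one vector at a time follows the inductive definition of
  \<open>dimension\<close>: independence modulo the ideal says that each new residue class lies
  outside the span of the earlier ones. This turns coefficients of the Hilbert series into
  cardinalities.\<close>

lemma dim_residue_class_span:
  fixes w :: "'b \<Rightarrow> ('n::finite, 'a::field) mpoly"
  assumes q: "q > 0" and fin: "finite B"
    and indep: "\<And>c. (\<Sum>b\<in>B. Const (c b) * w b) \<in> power_ideal q \<Longrightarrow> \<forall>b\<in>B. c b = 0"
  shows "ring.dim (quot_ring q) (range (\<lambda>c. residue_class q (Const c)))
    (range (\<lambda>c. residue_class q (\<Sum>b\<in>B. Const (c b) * w b))) = card B"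
proof -
  interpret Q: ring "quot_ring q :: ('n, 'a) mpoly set ring"
    by (rule ideal.quotient_is_ring[OF ideal_power_ideal])
  let ?K = "range (\<lambda>c. residue_class q (Const c :: ('n, 'a) mpoly))"
  let ?E = "\<lambda>B. range (\<lambda>c. residue_class q (\<Sum>b\<in>B. Const (c b) * w b))"
  have "Q.dimension (card B) ?K (?E B)"
    using fin indep
  proof (induction B rule: finite_induct)
    case empty
    have "?E {} = {\<zero>\<^bsub>quot_ring q\<^esub>}" by (auto simp: residue_class_0)
    then show ?case using Q.zero_dim by (simp only: card.empty)
  next
    case (insert b B)
    have cong: "(\<Sum>x\<in>B. Const ((c(b := k)) x) * w x) = (\<Sum>x\<in>B. Const (c x) * w x)" for c k
      using insert.hyps by (intro sum.cong) auto
    have "Q.dimension (card B) ?K (?E B)"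
    proof (rule insert.IH)
      fix c assume "(\<Sum>x\<in>B. Const (c x) * w x) \<in> power_ideal q"
      \<comment> \<open>A relation over B is a relation over \<open>insert b B\<close> with
        coefficient 0 at b.\<close>
      then have "\<forall>x\<in>insert b B. (c(b := 0)) x = 0"
        using insert.hyps cong[of c 0] by (intro insert.prems) simp
      then show "\<forall>x\<in>B. c x = 0" using insert.hyps by (auto split: if_splits)
    qed
    moreover have "residue_class q (w b) \<notin> ?E B"
    proof
      assume "residue_class q (w b) \<in> ?E B"
      then obtain c where "w b - (\<Sum>x\<in>B. Const (c x) * w x) \<in> power_ideal q"
        by (auto simp: residue_class_eq_iff)
      then have "(\<Sum>x\<in>B. Const (c x) * w x) - w b \<in> power_ideal q"
        by (simp add: power_ideal_diff_commute)
      \<comment> \<open>If \<open>w b\<close> were in the span, it would enter a relation with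
        coefficient -1, which is nonzero.\<close>
      then have "\<forall>x\<in>insert b B. (c(b := -1)) x = 0"
        using insert.hyps cong[of c "-1"] by (intro insert.prems) (simp add: Const_uminus)
      then show False by simp
    qed
    moreover have "residue_class q (w b) \<in> carrier (quot_ring q)"
      by (auto simp: carrier_quot_ring)
    ultimately have "Q.dimension (Suc (card B)) ?K (Q.line_extension ?K (residue_class q (w b)) (?E B))"
      by (intro Q.Suc_dim)
    moreover have "Q.line_extension ?K (residue_class q (w b)) (?E B) = ?E (insert b B)"
    proof -
      have 1: "\<exists>c. residue_class q (Const k) \<otimes>\<^bsub>quot_ring q\<^esub> residue_class q (w b) \<oplus>\<^bsub>quot_ring q\<^esub>
          residue_class q (\<Sum>x\<in>B. Const (d x) * w x) = residue_class q (\<Sum>x\<in>insert b B. Const (c x) * w x)" for k d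
        using insert.hyps cong[of d k]
        by (intro exI[of _ "d(b := k)"]) (simp flip: residue_class_add residue_class_mult)
      have 2: "\<exists>k d. residue_class q (\<Sum>x\<in>insert b B. Const (c x) * w x) =
          residue_class q (Const k) \<otimes>\<^bsub>quot_ring q\<^esub> residue_class q (w b) \<oplus>\<^bsub>quot_ring q\<^esub>
          residue_class q (\<Sum>x\<in>B. Const (d x) * w x)" for c
        using insert.hyps
        by (intro exI[of _ "c b"] exI[of _ c]) (simp flip: residue_class_add residue_class_mult)
      show ?thesis
      proof (intro equalityI subsetI)
        fix x assume "x \<in> Q.line_extension ?K (residue_class q (w b)) (?E B)"
        then obtain k d where x: "x = residue_class q (Const k) \<otimes>\<^bsub>quot_ring q\<^esub> residue_class q (w b) \<oplus>\<^bsub>quot_ring q\<^esub>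
            residue_class q (\<Sum>x\<in>B. Const (d x) * w x)"
          unfolding Q.line_extension_mem_iff by blast
        obtain c where "x = residue_class q (\<Sum>x\<in>insert b B. Const (c x) * w x)"
          using 1[of k d] unfolding x[symmetric] by (rule exE)
        then show "x \<in> ?E (insert b B)" by (rule range_eqI[where x = c])
      next
        fix x assume "x \<in> ?E (insert b B)"
        then obtain c where x: "x = residue_class q (\<Sum>x\<in>insert b B. Const (c x) * w x)" by (rule rangeE)
        obtain k d where "x = residue_class q (Const k) \<otimes>\<^bsub>quot_ring q\<^esub> residue_class q (w b) \<oplus>\<^bsub>quot_ring q\<^esub>
            residue_class q (\<Sum>x\<in>B. Const (d x) * w x)"
          using 2[of c] unfolding x[symmetric] by (elim exE)
        then show "x \<in> Q.line_extension ?K (residue_class q (w b)) (?E B)"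
          unfolding Q.line_extension_mem_iff by (intro bexI) (assumption, rule rangeI, rule rangeI)
      qed
    qed
    ultimately show ?case using insert.hyps by simp
  qed
  then show ?thesis
    using Q.dimI[OF subfield_constants[OF q]] by (simp add: over_def)
qed

section \<open>Frobenius\<close>

lemma CHAR_mpoly: "CHAR(('n, 'a::comm_ring_1) mpoly) = CHAR('a)"
proof (rule CHAR_eqI)
  show "of_nat CHAR('a) = (0 :: ('n, 'a) mpoly)"
    using Const_of_nat[of "CHAR('a)"] by (metis Const_simps(1) of_nat_CHAR)
next
  fix x assume "of_nat x = (0 :: ('n, 'a) mpoly)"
  then have "Poly_Mapping.lookup (of_nat x :: ('n, 'a) mpoly) 0 = 0" by simp
  then show "CHAR('a) dvd x" by (simp add: lookup_of_nat of_nat_eq_0_iff_char_dvd)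
qed

text \<open>Fermat's little theorem: every element is some \<open>of_nat i\<close>, and raising to
  the p-th power is additive in characteristic p.\<close>

lemma mod_ring_power_card: "(a :: 'p::prime_card mod_ring) ^ CARD('p) = a"
proof -
  obtain i where "a = of_nat i" using surj_of_nat_mod_ring by blast
  moreover have "(of_nat i :: 'p mod_ring) ^ CARD('p) = of_nat i"
  proof (induction i)
    case 0
    have "CARD('p) > 0" by simp
    then show ?case by (simp add: power_0_left)
  next
    case (Suc i)
    have "(of_nat (Suc i) :: 'p mod_ring) ^ CARD('p) = (of_nat i + 1) ^ CARD('p)" by (simp add: add.commute)
    also have "\<dots> = of_nat i ^ CARD('p) + 1 ^ CARD('p)"
      by (rule freshmans_dream) (simp_all add: prime_card)
    finally show ?case using Suc.IH by (simp add: add.commute)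
  qed
  ultimately show ?thesis by simp
qed

lemma mod_ring_power_card_pow: "(a :: 'p::prime_card mod_ring) ^ (CARD('p) ^ m) = a"
  by (induction m) (simp_all add: power_mult mod_ring_power_card)

lemma mod_ring_power_card_minus_1:
  assumes "(a :: 'p::prime_card mod_ring) \<noteq> 0"
  shows "a ^ (CARD('p) - 1) = 1"
proof -
  have "a * a ^ (CARD('p) - 1) = a"
    using mod_ring_power_card[of a] by (simp flip: power_Suc)
  with assms show ?thesis by simp
qed

text \<open>In characteristic p the q-th power of a linear form is the sum of the q-th powers of its
  terms. Hence the ideal is stable under every linear substitution, in particular under the action
  and under changes of coordinates.\<close>

lemma mod_ring_power_ideal_alg_hom:
  fixes f :: "('n::finite, 'p::prime_card mod_ring) mpoly"
  assumes "alg_hom \<phi>" "\<And>i. \<phi> (Var i) \<in> homogeneous 1" "f \<in> power_ideal (CARD('p) ^ m)"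
  shows "\<phi> f \<in> power_ideal (CARD('p) ^ m)"
proof (rule power_ideal_alg_hom[OF assms(1) _ assms(3)])
  fix i
  let ?q = "CARD('p) ^ m" and ?h = "\<phi> (Var i)"
  have "?h ^ ?q = (\<Sum>\<mu>\<in>Poly_Mapping.keys ?h. Poly_Mapping.single \<mu> (Poly_Mapping.lookup ?h \<mu>)) ^ ?q"
    by (metis poly_mapping_eq_sum_single)
  also have "\<dots> = (\<Sum>\<mu>\<in>Poly_Mapping.keys ?h. Poly_Mapping.single \<mu> (Poly_Mapping.lookup ?h \<mu>) ^ ?q)"
    by (rule freshmans_dream_sum') (simp_all add: CHAR_mpoly prime_card)
  also have "\<dots> \<in> power_ideal ?q"
  proof (rule power_ideal_sum)
    fix \<mu> assume "\<mu> \<in> Poly_Mapping.keys ?h"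
    with assms(2)[of i] have "(\<Sum>j\<in>UNIV. Poly_Mapping.lookup \<mu> j) = 1"
      by (auto simp: homogeneous_def)
    then obtain j where "Poly_Mapping.lookup \<mu> j \<noteq> 0"
      by (metis sum.neutral zero_neq_one)
    then have "Var j dvd (Var j ^ Poly_Mapping.lookup \<mu> j :: ('n, 'p mod_ring) mpoly)"
      by (simp add: dvd_power)
    also have "\<dots> dvd (\<Prod>i\<in>UNIV. Var i ^ Poly_Mapping.lookup \<mu> i)"
      by (rule dvd_prodI) auto
    finally have "Var j dvd Poly_Mapping.single \<mu> (Poly_Mapping.lookup ?h \<mu>)"
      unfolding single_eq_Const_times_Vars by (rule dvd_mult)
    then show "Poly_Mapping.single \<mu> (Poly_Mapping.lookup ?h \<mu>) ^ ?q \<in> power_ideal ?q"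
      by (intro Var_power_dvd_in_power_ideal dvd_power_same)
  qed
  finally show "?h ^ ?q \<in> power_ideal ?q" .
qed

section \<open>An adapted basis\<close>

text \<open>The product of \<open>Var i + Const c * Var i0\<close> over all c in the prime field,
  written in the form to which additivity of the p-th power applies.\<close>

definition orbit_poly :: "'n \<Rightarrow> 'n \<Rightarrow> ('n, 'p::prime_card mod_ring) mpoly" where
  "orbit_poly i0 i = Var i ^ CARD('p) - Var i * Var i0 ^ (CARD('p) - 1)"

text \<open>Each exponent off \<open>i0\<close> is divided by p with remainder; the p-th powers are
  replaced by orbit polynomials, so only the remainders react to transvections. The index is the
  exponent vector of the monomial with the lowest power of \<open>Var i0\<close>.\<close>

definition basis_poly :: "'n::finite \<Rightarrow> ('n \<Rightarrow> nat) \<Rightarrow> ('n, 'p::prime_card mod_ring) mpoly" where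
  "basis_poly i0 \<mu> = Var i0 ^ \<mu> i0 *
     (\<Prod>i\<in>-{i0}. orbit_poly i0 i ^ (\<mu> i div CARD('p)) * Var i ^ (\<mu> i mod CARD('p)))"

text \<open>Exponent vectors of the degree d monomials outside the ideal, as plain functions so that
  they can be updated and counted as a product set.\<close>

definition exponents :: "nat \<Rightarrow> nat \<Rightarrow> ('n::finite \<Rightarrow> nat) set" where
  "exponents q d = {\<mu>. (\<forall>i. \<mu> i < q) \<and> sum \<mu> UNIV = d}"

lemma finite_bounded_exponents: "finite {\<mu> :: 'n::finite \<Rightarrow> nat. \<forall>i. \<mu> i < q}"
proof -
  have "{\<mu> :: 'n \<Rightarrow> nat. \<forall>i. \<mu> i < q} = PiE UNIV (\<lambda>_. {..<q})" by (auto simp: PiE_def)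
  then show ?thesis by (simp add: finite_PiE)
qed

lemma finite_exponents: "finite (exponents q d :: ('n::finite \<Rightarrow> nat) set)"
  by (rule finite_subset[OF _ finite_bounded_exponents[of q]]) (auto simp: exponents_def)

lemma prime_card_gt_1: "CARD('p::prime_card) > 1"
  using prime_card[where 'a='p] by (rule prime_gt_1_nat)

lemma homogeneous_basis_poly:
  fixes i0 :: "'n::finite"
  shows "(basis_poly i0 \<mu> :: ('n, 'p::prime_card mod_ring) mpoly) \<in> homogeneous (sum \<mu> UNIV)"
proof -
  let ?p = "CARD('p)"
  have V: "Var i ^ k \<in> (homogeneous k :: ('n, 'p mod_ring) mpoly set)" for i k
    using homogeneous_power[OF homogeneous_Var, of i k] by simp
  have "Var i * Var i0 ^ (?p - 1) \<in> (homogeneous ?p :: ('n, 'p mod_ring) mpoly set)" for i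
    using homogeneous_mult[OF homogeneous_Var V[of i0 "?p - 1"], of i] prime_card_gt_1[where 'p='p] by simp
  then have "(orbit_poly i0 i :: ('n, 'p mod_ring) mpoly) \<in> homogeneous ?p" for i
    unfolding orbit_poly_def by (intro homogeneous_diff V)
  then have "(basis_poly i0 \<mu> :: ('n, 'p mod_ring) mpoly)
      \<in> homogeneous (\<mu> i0 + (\<Sum>i\<in>-{i0}. ?p * (\<mu> i div ?p) + \<mu> i mod ?p))"
    unfolding basis_poly_def by (intro homogeneous_mult homogeneous_prod homogeneous_power V)
  also have "\<mu> i0 + (\<Sum>i\<in>-{i0}. ?p * (\<mu> i div ?p) + \<mu> i mod ?p) = sum \<mu> UNIV"
    by (simp add: sum.remove[of UNIV i0] Compl_eq_Diff_UNIV)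
  finally show ?thesis .
qed

lemma dvd_prod_diff:
  fixes f g :: "'b \<Rightarrow> 'a::comm_ring_1"
  assumes "\<And>i. i \<in> A \<Longrightarrow> y dvd f i - g i"
  shows "y dvd prod f A - prod g A"
  using assms
proof (induction A rule: infinite_finite_induct)
  case (insert i A)
  have "prod f (insert i A) - prod g (insert i A) = (f i - g i) * prod f A + g i * (prod f A - prod g A)"
    using insert.hyps by (simp add: algebra_simps)
  with insert show ?case by (simp add: dvd_add)
qed simp_all

lemma dvd_power_diff: "y dvd f - g \<Longrightarrow> y dvd f ^ k - g ^ k" for y :: "'a::comm_ring_1"
  using dvd_prod_diff[of "{..<k}" y "\<lambda>_. f" "\<lambda>_. g"] by simp

lemma dvd_mult_diff: "y dvd f - g \<Longrightarrow> y dvd f' - g' \<Longrightarrow> y dvd f * f' - g * g'" for y :: "'a::comm_ring_1"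
proof -
  assume "y dvd f - g" "y dvd f' - g'"
  then have "y dvd (f - g) * f' + g * (f' - g')" by (simp add: dvd_add)
  then show ?thesis by (simp add: algebra_simps)
qed

text \<open>Modulo \<open>Var i0\<close> every orbit polynomial is the p-th power of its variable,
  and the common factor \<open>Var i0 ^ \<mu> i0\<close> raises the congruence. This triangularity
  yields both spanning and independence.\<close>

lemma basis_poly_diff_monomial:
  fixes i0 :: "'n::finite"
  shows "Var i0 ^ Suc (\<mu> i0) dvd (basis_poly i0 \<mu> :: ('n, 'p::prime_card mod_ring) mpoly) - (\<Prod>i\<in>UNIV. Var i ^ \<mu> i)"
proof -
  let ?p = "CARD('p)" and ?y = "Var i0 :: ('n, 'p mod_ring) mpoly"
  let ?A = "\<Prod>i\<in>-{i0}. orbit_poly i0 i ^ (\<mu> i div ?p) * Var i ^ (\<mu> i mod ?p) :: ('n, 'p mod_ring) mpoly"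
  let ?B = "\<Prod>i\<in>-{i0}. (Var i ^ ?p) ^ (\<mu> i div ?p) * Var i ^ (\<mu> i mod ?p) :: ('n, 'p mod_ring) mpoly"
  have "?y dvd orbit_poly i0 i - Var i ^ ?p" for i
    using prime_card_gt_1[where 'p='p] by (simp add: orbit_poly_def dvd_power)
  then have "?y dvd ?A - ?B"
    by (intro dvd_prod_diff dvd_mult_diff dvd_power_diff) simp_all
  then have "?y ^ Suc (\<mu> i0) dvd ?y ^ \<mu> i0 * (?A - ?B)"
    unfolding power_Suc2 by (intro mult_dvd_mono dvd_refl)
  also have "?y ^ \<mu> i0 * ?B = (\<Prod>i\<in>UNIV. Var i ^ \<mu> i)"
    by (simp add: prod.remove[of UNIV i0] Compl_eq_Diff_UNIV flip: power_mult power_add)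
  then have "?y ^ \<mu> i0 * (?A - ?B) = basis_poly i0 \<mu> - (\<Prod>i\<in>UNIV. Var i ^ \<mu> i)"
    by (simp add: basis_poly_def algebra_simps)
  finally show ?thesis .
qed

lemma keys_dvd_Var_power:
  assumes "Var i ^ k dvd (f :: ('n, 'a::comm_ring_1) mpoly)" "\<nu> \<in> Poly_Mapping.keys f"
  shows "k \<le> Poly_Mapping.lookup \<nu> i"
proof -
  obtain h where "f = Var i ^ k * h" using assms(1) by (rule dvdE)
  then obtain a b where "\<nu> = a + b" "a \<in> Poly_Mapping.keys (Var i ^ k :: ('n, 'a) mpoly)"
    using assms(2) keys_mult by blast
  then show ?thesis by (auto simp: Var_power lookup_add split: if_splits)
qed

text \<open>A monomial outside the ideal is its basis polynomial plus monomials of the same degree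
  with a larger exponent at \<open>i0\<close>. That exponent is at most d, so the rewriting
  ends.\<close>

lemma basis_poly_spans:
  fixes i0 :: "'n::finite" and f :: "('n, 'p::prime_card mod_ring) mpoly"
  assumes "f \<in> homogeneous d"
  obtains c where "f - (\<Sum>\<mu>\<in>exponents q d. Const (c \<mu>) * basis_poly i0 \<mu>) \<in> power_ideal q"
proof -
  define Sp where "Sp = {f :: ('n, 'p mod_ring) mpoly.
    \<exists>c. f - (\<Sum>\<mu>\<in>exponents q d. Const (c \<mu>) * basis_poly i0 \<mu>) \<in> power_ideal q}"
  have ideal: "f \<in> Sp" if "f \<in> power_ideal q" for f
    unfolding Sp_def mem_Collect_eq using that by (intro exI[of _ "\<lambda>_. 0"]) simp
  have add: "f + g \<in> Sp" if fg: "f \<in> Sp" "g \<in> Sp" for f g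
  proof -
    obtain c c' where "f - (\<Sum>\<mu>\<in>exponents q d. Const (c \<mu>) * basis_poly i0 \<mu>) \<in> power_ideal q"
      "g - (\<Sum>\<mu>\<in>exponents q d. Const (c' \<mu>) * basis_poly i0 \<mu>) \<in> power_ideal q"
      using fg unfolding Sp_def by blast
    from power_ideal_add[OF this] show ?thesis
      unfolding Sp_def mem_Collect_eq
      by (intro exI[of _ "\<lambda>\<mu>. c \<mu> + c' \<mu>"]) (simp add: Const_add algebra_simps sum.distrib)
  qed
  have scale: "Const k * f \<in> Sp" if f: "f \<in> Sp" for f k
  proof -
    obtain c where "f - (\<Sum>\<mu>\<in>exponents q d. Const (c \<mu>) * basis_poly i0 \<mu>) \<in> power_ideal q"
      using f unfolding Sp_def by blast
    from power_ideal_mult[OF this, of "Const k"] show ?thesis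
      unfolding Sp_def mem_Collect_eq
      by (intro exI[of _ "\<lambda>\<mu>. k * c \<mu>"]) (simp add: Const_mult algebra_simps sum_distrib_left)
  qed
  have sum: "sum g A \<in> Sp" if "\<And>a. a \<in> A \<Longrightarrow> g a \<in> Sp" for g :: "('n \<Rightarrow>\<^sub>0 nat) \<Rightarrow> _" and A
    using that by (induction A rule: infinite_finite_induct) (simp_all add: add ideal power_ideal_0)
  have basis: "basis_poly i0 \<mu> \<in> Sp" if "\<mu> \<in> exponents q d" for \<mu>
  proof -
    have "(\<Sum>\<nu>\<in>exponents q d. Const (if \<nu> = \<mu> then 1 else 0) * basis_poly i0 \<nu>) =
        (\<Sum>\<nu>\<in>exponents q d. if \<nu> = \<mu> then basis_poly i0 \<nu> else 0 :: ('n, 'p mod_ring) mpoly)"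
      by (intro sum.cong) auto
    then show ?thesis
      using that unfolding Sp_def mem_Collect_eq
      by (intro exI[of _ "\<lambda>\<nu>. if \<nu> = \<mu> then 1 else 0"]) (simp add: finite_exponents power_ideal_0)
  qed
  have mono: "(\<Prod>i\<in>UNIV. Var i ^ Poly_Mapping.lookup \<nu> i) \<in> Sp"
    if "sum (Poly_Mapping.lookup \<nu>) UNIV = d" for \<nu>
    using that
  proof (induction "d - Poly_Mapping.lookup \<nu> i0" arbitrary: \<nu> rule: less_induct)
    case less
    let ?m = "\<Prod>i\<in>UNIV. Var i ^ Poly_Mapping.lookup \<nu> i :: ('n, 'p mod_ring) mpoly"
    let ?b = "basis_poly i0 (Poly_Mapping.lookup \<nu>) :: ('n, 'p mod_ring) mpoly"
    show ?case
    proof (cases "\<forall>i. Poly_Mapping.lookup \<nu> i < q")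
      case False
      then have "?m \<in> power_ideal q" by (auto simp: prod_Var_power in_power_ideal_iff not_less)
      then show ?thesis by (rule ideal)
    next
      case True
      have "?m \<in> homogeneous d"
        using less.prems by (simp add: prod_Var_power homogeneous_def)
      then have hom: "?m - ?b \<in> homogeneous d"
        using homogeneous_basis_poly[of i0 "Poly_Mapping.lookup \<nu>"] less.prems
        by (intro homogeneous_diff) simp_all
      have "?m - ?b \<in> Sp"
      proof (subst poly_mapping_eq_sum_single, rule sum)
        fix \<kappa> assume \<kappa>: "\<kappa> \<in> Poly_Mapping.keys (?m - ?b)"
        have "Var i0 ^ Suc (Poly_Mapping.lookup \<nu> i0) dvd ?m - ?b"
          using basis_poly_diff_monomial by (subst minus_diff_eq[symmetric]) (simp only: dvd_minus_iff)
        then have "Suc (Poly_Mapping.lookup \<nu> i0) \<le> Poly_Mapping.lookup \<kappa> i0"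
          using \<kappa> by (rule keys_dvd_Var_power)
        moreover have d: "sum (Poly_Mapping.lookup \<kappa>) UNIV = d"
          using hom \<kappa> by (simp add: homogeneous_def)
        \<comment> \<open>The bound makes the truncated difference
          \<open>d - Poly_Mapping.lookup \<kappa> i0\<close> strictly smaller than the one for
          \<open>\<nu>\<close>.\<close>
        moreover from d have "Poly_Mapping.lookup \<kappa> i0 \<le> d"
          using member_le_sum[of i0 UNIV "Poly_Mapping.lookup \<kappa>"] by simp
        ultimately show "Poly_Mapping.single \<kappa> (Poly_Mapping.lookup (?m - ?b) \<kappa>) \<in> Sp"
          unfolding single_eq_Const_times_Vars by (intro scale less.hyps) simp_all
      qed
      moreover have "?b \<in> Sp" using True less.prems by (intro basis) (simp add: exponents_def)
      ultimately have "?m - ?b + ?b \<in> Sp" by (rule add)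
      then show ?thesis by simp
    qed
  qed
  have "f \<in> Sp"
  proof (subst poly_mapping_eq_sum_single, rule sum)
    fix \<nu> assume "\<nu> \<in> Poly_Mapping.keys f"
    with assms show "Poly_Mapping.single \<nu> (Poly_Mapping.lookup f \<nu>) \<in> Sp"
      unfolding single_eq_Const_times_Vars by (intro scale mono) (simp add: homogeneous_def)
  qed
  then show ?thesis unfolding Sp_def using that by blast
qed

text \<open>Among the indices with nonzero coefficient take one with the least exponent at
  \<open>i0\<close>. By triangularity its monomial occurs in no other summand, and it does not
  belong to the ideal.\<close>

lemma basis_poly_independent:
  fixes i0 :: "'n::finite" and c :: "('n \<Rightarrow> nat) \<Rightarrow> 'p::prime_card mod_ring"
  assumes "B \<subseteq> exponents q d" "(\<Sum>\<mu>\<in>B. Const (c \<mu>) * basis_poly i0 \<mu>) \<in> power_ideal q" "\<mu> \<in> B"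
  shows "c \<mu> = 0"
proof (rule ccontr)
  assume "c \<mu> \<noteq> 0"
  have fin: "finite B" using assms(1) finite_exponents by (rule finite_subset)
  obtain \<nu> where \<nu>: "\<nu> \<in> B" "c \<nu> \<noteq> 0" and min: "\<And>\<kappa>. \<kappa> \<in> B \<Longrightarrow> c \<kappa> \<noteq> 0 \<Longrightarrow> \<nu> i0 \<le> \<kappa> i0"
    using ex_has_least_nat[of "\<lambda>\<nu>. \<nu> \<in> B \<and> c \<nu> \<noteq> 0" \<mu> "\<lambda>\<nu>. \<nu> i0"] assms(3) \<open>c \<mu> \<noteq> 0\<close> by blast
  define n where "n = Abs_poly_mapping \<nu>"
  have n: "Poly_Mapping.lookup n = \<nu>" by (simp add: n_def)
  have coeff: "c \<kappa> * Poly_Mapping.lookup (basis_poly i0 \<kappa>) n = (if \<kappa> = \<nu> then c \<nu> else 0)" if "\<kappa> \<in> B" for \<kappa>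
  proof (cases "c \<kappa> = 0")
    case False
    let ?D = "basis_poly i0 \<kappa> - (\<Prod>i\<in>UNIV. Var i ^ \<kappa> i) :: ('n, 'p mod_ring) mpoly"
    define k where "k = Abs_poly_mapping \<kappa>"
    have k: "Poly_Mapping.lookup k = \<kappa>" by (simp add: k_def)
    \<comment> \<open>All monomials of \<open>?D\<close> have exponent above
      \<open>\<kappa> i0\<close> at \<open>i0\<close>, hence above \<open>\<nu> i0\<close>.\<close>
    have "n \<notin> Poly_Mapping.keys ?D"
      using keys_dvd_Var_power[OF basis_poly_diff_monomial, of n i0 \<kappa>] min[OF that False] n by force
    then have "Poly_Mapping.lookup (basis_poly i0 \<kappa>) n =
        Poly_Mapping.lookup (\<Prod>i\<in>UNIV. Var i ^ \<kappa> i :: ('n, 'p mod_ring) mpoly) n"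
      by (simp add: in_keys_iff lookup_minus)
    also have "k = n \<longleftrightarrow> \<kappa> = \<nu>"
      by (metis k n poly_mapping_eqI)
    then have "Poly_Mapping.lookup (\<Prod>i\<in>UNIV. Var i ^ \<kappa> i :: ('n, 'p mod_ring) mpoly) n = (if \<kappa> = \<nu> then 1 else 0)"
      using prod_Var_power[of k, where 'a="'p mod_ring"] by (simp add: k lookup_single when_def)
    finally show ?thesis by simp
  qed (use \<nu> in auto)
  have "Poly_Mapping.lookup (\<Sum>\<mu>\<in>B. Const (c \<mu>) * basis_poly i0 \<mu>) n = (\<Sum>\<mu>\<in>B. if \<mu> = \<nu> then c \<nu> else 0)"
    unfolding lookup_sum lookup_Const_mult by (rule sum.cong) (simp_all add: coeff)
  also have "\<dots> = c \<nu>" using fin \<nu> by simp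
  finally have "n \<in> Poly_Mapping.keys (\<Sum>\<mu>\<in>B. Const (c \<mu>) * basis_poly i0 \<mu>)"
    using \<nu> by (simp add: in_keys_iff)
  with assms(2) obtain i where "q \<le> \<nu> i" by (auto simp: in_power_ideal_iff n)
  moreover have "\<nu> i < q" using \<nu> assms(1) by (auto simp: exponents_def)
  ultimately show False by simp
qed

section \<open>The group action in adapted coordinates\<close>

text \<open>The action of an element with root \<open>\<alpha>\<close> once the form l has become
  the variable \<open>i0\<close>; \<open>\<zeta>\<close> stands for the eigenvalue
  \<open>1 + l \<alpha>\<close>.\<close>

definition shear :: "'n::finite \<Rightarrow> ('n \<Rightarrow> 'a::comm_ring_1) \<Rightarrow> 'a \<Rightarrow> ('n, 'a) mpoly \<Rightarrow> ('n, 'a) mpoly" where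
  "shear i0 \<alpha> \<zeta> = subst (\<lambda>i. if i = i0 then Const \<zeta> * Var i0 else Var i + Const (\<alpha> i) * Var i0)"

lemma alg_hom_shear: "alg_hom (shear i0 \<alpha> \<zeta>)"
  by (simp add: shear_def alg_hom_subst)

lemma shear_Var:
  "shear i0 \<alpha> \<zeta> (Var i0) = Const \<zeta> * Var i0"
  "i \<noteq> i0 \<Longrightarrow> shear i0 \<alpha> \<zeta> (Var i) = Var i + Const (\<alpha> i) * Var i0"
  by (simp_all add: shear_def subst_Var)

text \<open>With x, y for the two variables and a for the shift, both \<open>(x + a y)^p\<close> and
  \<open>(x + a y) (\<zeta> y)^(p-1)\<close> acquire the same extra term \<open>a y^p\<close>, since
  \<open>a^p = a\<close> and \<open>\<zeta>^(p-1) = 1\<close>.\<close>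

lemma shear_orbit_poly:
  fixes i0 :: "'n::finite" and \<zeta> :: "'p::prime_card mod_ring"
  assumes "i \<noteq> i0" "\<zeta> \<noteq> 0"
  shows "shear i0 \<alpha> \<zeta> (orbit_poly i0 i) = orbit_poly i0 i"
proof -
  let ?p = "CARD('p)" and ?a = "Const (\<alpha> i) :: ('n, 'p mod_ring) mpoly"
  have "(Var i + ?a * Var i0) ^ ?p = Var i ^ ?p + (?a * Var i0) ^ ?p"
    by (rule freshmans_dream) (simp_all add: CHAR_mpoly prime_card)
  also have "(?a * Var i0) ^ ?p = ?a * Var i0 ^ ?p"
    by (simp add: power_mult_distrib mod_ring_power_card flip: Const_power)
  also have "Var i0 ^ ?p = (Var i0 * Var i0 ^ (?p - 1) :: ('n, 'p mod_ring) mpoly)"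
    by (simp flip: power_Suc)
  finally have "(Var i + ?a * Var i0) ^ ?p = Var i ^ ?p + ?a * (Var i0 * Var i0 ^ (?p - 1))" .
  moreover have "(Const \<zeta> * Var i0) ^ (?p - 1) = (Var i0 ^ (?p - 1) :: ('n, 'p mod_ring) mpoly)"
    using assms(2) by (simp add: power_mult_distrib mod_ring_power_card_minus_1 flip: Const_power del: One_nat_def)
  ultimately show ?thesis
    using assms(1)
    by (simp add: orbit_poly_def alg_hom_simps[OF alg_hom_shear] shear_Var algebra_simps del: One_nat_def)
qed

lemma shear_basis_poly:
  fixes i0 :: "'n::finite" and \<zeta> :: "'p::prime_card mod_ring"
  assumes "\<zeta> \<noteq> 0"
  shows "shear i0 \<alpha> \<zeta> (basis_poly i0 \<mu>) = Const (\<zeta> ^ \<mu> i0) * Var i0 ^ \<mu> i0 *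
    (\<Prod>i\<in>-{i0}. orbit_poly i0 i ^ (\<mu> i div CARD('p)) * (Var i + Const (\<alpha> i) * Var i0) ^ (\<mu> i mod CARD('p)))"
proof -
  have "(\<Prod>i\<in>-{i0}. shear i0 \<alpha> \<zeta> (orbit_poly i0 i) ^ (\<mu> i div CARD('p)) * shear i0 \<alpha> \<zeta> (Var i) ^ (\<mu> i mod CARD('p))) =
    (\<Prod>i\<in>-{i0}. orbit_poly i0 i ^ (\<mu> i div CARD('p)) * (Var i + Const (\<alpha> i) * Var i0) ^ (\<mu> i mod CARD('p)))"
    by (rule prod.cong) (simp_all add: shear_orbit_poly shear_Var assms)
  then show ?thesis
    by (simp add: basis_poly_def alg_hom_simps[OF alg_hom_shear] shear_Var(1) power_mult_distrib Const_power)
qed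

text \<open>Only the remainder power of \<open>Var k\<close> is moved, and the binomial theorem
  expands it. Since j does not exceed the remainder, lowering the exponent by j keeps the quotient
  by p, so every term is again a basis polynomial.\<close>

lemma shear_transvection_basis_poly:
  fixes i0 k :: "'n::finite"
  assumes "k \<noteq> i0"
  shows "shear i0 (\<lambda>i. if i = k then 1 else 0) 1 (basis_poly i0 \<mu> :: ('n, 'p::prime_card mod_ring) mpoly) =
    (\<Sum>j\<le>\<mu> k mod CARD('p). Const (of_nat ((\<mu> k mod CARD('p)) choose j)) *
       basis_poly i0 (\<mu>(k := \<mu> k - j, i0 := \<mu> i0 + j)))"
proof -
  let ?p = "CARD('p)" and ?r = "\<mu> k mod CARD('p)"
  let ?F = "\<lambda>i. orbit_poly i0 i ^ (\<mu> i div ?p) :: ('n, 'p mod_ring) mpoly"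
  define P where "P = (\<Prod>i\<in>-{i0}-{k}. ?F i * Var i ^ (\<mu> i mod ?p))"
  have split: "prod f (-{i0}) = f k * prod f (-{i0}-{k})" for f :: "'n \<Rightarrow> ('n, 'p mod_ring) mpoly"
    using assms by (intro prod.remove) auto
  have "(\<Prod>i\<in>-{i0}-{k}. ?F i * (Var i + Const (if i = k then 1 else 0) * Var i0) ^ (\<mu> i mod ?p)) = P"
    unfolding P_def by (rule prod.cong) auto
  then have "shear i0 (\<lambda>i. if i = k then 1 else 0) 1 (basis_poly i0 \<mu>) =
      Var i0 ^ \<mu> i0 * (?F k * (Var i0 + Var k) ^ ?r * P)"
    by (simp add: shear_basis_poly split add.commute)
  also have "\<dots> = (\<Sum>j\<le>?r. of_nat (?r choose j) * (Var i0 ^ (\<mu> i0 + j) * (?F k * Var k ^ (?r - j) * P)))"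
    unfolding binomial_ring by (simp add: sum_distrib_left sum_distrib_right power_add mult_ac)
  also have "\<dots> = (\<Sum>j\<le>?r. Const (of_nat (?r choose j)) * basis_poly i0 (\<mu>(k := \<mu> k - j, i0 := \<mu> i0 + j)))"
  proof (rule sum.cong)
    fix j assume "j \<in> {..?r}"
    then have j: "j \<le> ?r" by simp
    have "\<mu> k - j = ?p * (\<mu> k div ?p) + (?r - j)"
      using j mult_div_mod_eq[of ?p "\<mu> k"] by linarith
    moreover have "?r - j < ?p" by (simp add: less_imp_diff_less)
    ultimately have "(\<mu> k - j) div ?p = \<mu> k div ?p" "(\<mu> k - j) mod ?p = ?r - j" by simp_all
    moreover have "(\<Prod>i\<in>-{i0}-{k}. orbit_poly i0 i ^ ((\<mu>(k := \<mu> k - j, i0 := \<mu> i0 + j)) i div ?p) *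
        Var i ^ ((\<mu>(k := \<mu> k - j, i0 := \<mu> i0 + j)) i mod ?p)) = P"
      unfolding P_def by (rule prod.cong) auto
    ultimately show "of_nat (?r choose j) * (Var i0 ^ (\<mu> i0 + j) * (?F k * Var k ^ (?r - j) * P)) =
        Const (of_nat (?r choose j)) * basis_poly i0 (\<mu>(k := \<mu> k - j, i0 := \<mu> i0 + j))"
      using assms by (simp add: basis_poly_def split Const_of_nat)
  qed simp
  finally show ?thesis .
qed

lemma shear_basis_poly_invariant:
  fixes i0 :: "'n::finite" and \<zeta> :: "'p::prime_card mod_ring"
  assumes "\<zeta> \<noteq> 0" "\<And>i. i \<noteq> i0 \<Longrightarrow> CARD('p) dvd \<mu> i" "\<zeta> ^ \<mu> i0 = 1"
  shows "shear i0 \<alpha> \<zeta> (basis_poly i0 \<mu>) = basis_poly i0 \<mu>"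
proof -
  have "(\<Prod>i\<in>-{i0}. orbit_poly i0 i ^ (\<mu> i div CARD('p)) * (Var i + Const (\<alpha> i) * Var i0) ^ (\<mu> i mod CARD('p))) =
    (\<Prod>i\<in>-{i0}. orbit_poly i0 i ^ (\<mu> i div CARD('p)) * Var i ^ (\<mu> i mod CARD('p)))"
    by (rule prod.cong) (use assms(2) in auto)
  then show ?thesis
    unfolding shear_basis_poly[OF assms(1)] by (simp add: basis_poly_def assms(3))
qed

text \<open>The shifts alter the factors off \<open>i0\<close> only by multiples of
  \<open>Var i0\<close>; times \<open>Var i0 ^ (q - 1)\<close> these vanish in the quotient.\<close>

lemma shear_basis_poly_invariant_top:
  fixes i0 :: "'n::finite" and \<zeta> :: "'p::prime_card mod_ring"
  assumes "\<zeta> \<noteq> 0" "Suc (\<mu> i0) = q" "\<zeta> ^ \<mu> i0 = 1"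
  shows "shear i0 \<alpha> \<zeta> (basis_poly i0 \<mu>) - basis_poly i0 \<mu> \<in> power_ideal q"
proof -
  let ?A = "\<Prod>i\<in>-{i0}. orbit_poly i0 i ^ (\<mu> i div CARD('p)) * (Var i + Const (\<alpha> i) * Var i0) ^ (\<mu> i mod CARD('p))"
  let ?B = "\<Prod>i\<in>-{i0}. orbit_poly i0 i ^ (\<mu> i div CARD('p)) * Var i ^ (\<mu> i mod CARD('p)) :: ('n, 'p mod_ring) mpoly"
  have "Var i0 dvd ?A - ?B"
    by (intro dvd_prod_diff dvd_mult_diff dvd_power_diff) simp_all
  then have "Var i0 ^ q dvd Var i0 ^ \<mu> i0 * (?A - ?B)"
    unfolding assms(2)[symmetric] power_Suc2 by (intro mult_dvd_mono dvd_refl)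
  also have "Var i0 ^ \<mu> i0 * (?A - ?B) = shear i0 \<alpha> \<zeta> (basis_poly i0 \<mu>) - basis_poly i0 \<mu>"
    unfolding shear_basis_poly[OF assms(1)] by (simp add: basis_poly_def assms(3) right_diff_distrib)
  finally show ?thesis by (rule Var_power_dvd_in_power_ideal)
qed

lemma shear_scaling_basis_poly:
  fixes i0 :: "'n::finite" and \<zeta> :: "'p::prime_card mod_ring"
  assumes "\<zeta> \<noteq> 0"
  shows "shear i0 (\<lambda>_. 0) \<zeta> (basis_poly i0 \<mu>) = Const (\<zeta> ^ \<mu> i0) * basis_poly i0 \<mu>"
  unfolding shear_basis_poly[OF assms] by (simp add: basis_poly_def mult.assoc)

section \<open>Coefficients of invariants in the adapted basis\<close>

lemma basis_poly_in_power_ideal: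
  "q \<le> \<mu> i0 \<Longrightarrow> basis_poly i0 \<mu> \<in> power_ideal q"
  unfolding basis_poly_def
  by (intro Var_power_dvd_in_power_ideal[of i0] dvd_mult2 le_imp_power_dvd)

text \<open>Pure scalings are diagonal in the adapted basis, so independence compares eigenvalues
  coefficient by coefficient.\<close>

lemma scaling_invariant_coefficients:
  fixes i0 :: "'n::finite" and c :: "('n \<Rightarrow> nat) \<Rightarrow> 'p::prime_card mod_ring" and q d :: nat
  defines "f \<equiv> \<Sum>\<mu>\<in>exponents q d. Const (c \<mu>) * basis_poly i0 \<mu>"
  assumes "\<zeta> \<noteq> 0" "shear i0 (\<lambda>_. 0) \<zeta> f - f \<in> power_ideal q" "\<mu> \<in> exponents q d" "c \<mu> \<noteq> 0"
  shows "\<zeta> ^ \<mu> i0 = 1"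
proof -
  have "shear i0 (\<lambda>_. 0) \<zeta> f - f = (\<Sum>\<mu>\<in>exponents q d. Const (c \<mu> * (\<zeta> ^ \<mu> i0 - 1)) * basis_poly i0 \<mu>)"
    unfolding f_def alg_hom_simps[OF alg_hom_shear] shear_scaling_basis_poly[OF assms(2)] sum_subtractf[symmetric]
    by (rule sum.cong) (simp_all add: Const_mult Const_diff algebra_simps)
  with assms(3) have "c \<mu> * (\<zeta> ^ \<mu> i0 - 1) = 0"
    using basis_poly_independent[where c = "\<lambda>\<mu>. c \<mu> * (\<zeta> ^ \<mu> i0 - 1)", OF subset_refl _ assms(4)]
    by (simp only:)
  with assms(5) show ?thesis by simp
qed

text \<open>Induction on \<open>\<mu> i0\<close>: compare the coefficients at the index reached from
  \<open>\<mu>\<close> by moving one unit of exponent from k to \<open>i0\<close>. Every other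
  contribution comes from an index with a smaller exponent at \<open>i0\<close>, whose coefficient
  already vanishes.\<close>

lemma transvection_invariant_coefficients:
  fixes i0 k :: "'n::finite" and c :: "('n \<Rightarrow> nat) \<Rightarrow> 'p::prime_card mod_ring" and q d :: nat
  defines "f \<equiv> \<Sum>\<mu>\<in>exponents q d. Const (c \<mu>) * basis_poly i0 \<mu>"
  assumes k: "k \<noteq> i0" and inv: "shear i0 (\<lambda>i. if i = k then 1 else 0) 1 f - f \<in> power_ideal q"
    and \<mu>: "\<mu> \<in> exponents q d" "\<not> CARD('p) dvd \<mu> k" "Suc (\<mu> i0) < q"
  shows "c \<mu> = 0"
proof -
  let ?p = "CARD('p)" and ?E = "exponents q d :: ('n \<Rightarrow> nat) set"
  \<comment> \<open>\<open>T\<close> is the index and \<open>a\<close> the coefficient of the j-th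
    binomial term. \<open>P\<close> starts at j = 1 because the term j = 0 cancels against f, and
    \<open>P'\<close> keeps the terms outside the ideal.\<close>
  define T where "T = (\<lambda>(\<mu> :: 'n \<Rightarrow> nat, j). \<mu>(k := \<mu> k - j, i0 := \<mu> i0 + j))"
  define a where "a = (\<lambda>(\<mu>, j). c \<mu> * of_nat ((\<mu> k mod ?p) choose j))"
  define P where "P = Sigma ?E (\<lambda>\<mu>. {1..\<mu> k mod ?p})"
  define P' where "P' = {x \<in> P. T x i0 < q}"
  have fin: "finite P" "finite P'"
    unfolding P'_def P_def by (simp_all add: finite_exponents)
  have T_in: "T x \<in> ?E" if x': "x \<in> P'" for x
  proof -
    obtain \<mu> j where x: "x = (\<mu>, j)" "\<mu> \<in> ?E" "j \<le> \<mu> k mod ?p" "\<mu> i0 + j < q"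
      using x' k by (auto simp: P'_def P_def T_def)
    then have "j \<le> \<mu> k" using mod_less_eq_dividend order_trans by blast
    moreover have "sum g UNIV = g i0 + (g k + sum g (UNIV - {i0} - {k}))" for g :: "'n \<Rightarrow> nat"
      using k by (simp add: sum.remove[of UNIV i0] sum.remove[of "UNIV - {i0}" k])
    moreover have "sum (\<mu>(k := \<mu> k - j, i0 := \<mu> i0 + j)) (UNIV - {i0} - {k}) = sum \<mu> (UNIV - {i0} - {k})"
      by (rule sum.cong) auto
    ultimately have "sum (\<mu>(k := \<mu> k - j, i0 := \<mu> i0 + j)) UNIV = sum \<mu> UNIV"
      using k by simp
    then show ?thesis
      using x by (auto simp: T_def exponents_def less_imp_diff_less)
  qed
  have "shear i0 (\<lambda>i. if i = k then 1 else 0) 1 f - f =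
      (\<Sum>\<mu>\<in>?E. \<Sum>j\<in>{1..\<mu> k mod ?p}. Const (a (\<mu>, j)) * basis_poly i0 (T (\<mu>, j)))"
  proof -
    have "Const (c \<mu>) * shear i0 (\<lambda>i. if i = k then 1 else 0) 1 (basis_poly i0 \<mu>) - Const (c \<mu>) * basis_poly i0 \<mu> =
      (\<Sum>j\<in>{1..\<mu> k mod ?p}. Const (a (\<mu>, j)) * basis_poly i0 (T (\<mu>, j)))" for \<mu>
    proof -
      have "{..\<mu> k mod ?p} = insert 0 {1..\<mu> k mod ?p}" by auto
      then show ?thesis
        unfolding shear_transvection_basis_poly[OF k]
        by (simp add: a_def T_def sum_distrib_left distrib_left Const_mult mult.assoc)
    qed
    then show ?thesis
      by (simp add: f_def alg_hom_simps[OF alg_hom_shear] flip: sum_subtractf)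
  qed
  also have "\<dots> = (\<Sum>x\<in>P. Const (a x) * basis_poly i0 (T x))"
    unfolding P_def by (subst sum.Sigma) (simp_all add: finite_exponents split_def)
  also have "\<dots> = (\<Sum>x\<in>P'. Const (a x) * basis_poly i0 (T x)) + (\<Sum>x\<in>P - P'. Const (a x) * basis_poly i0 (T x))"
    using fin by (subst sum.subset_diff[of P' P]) (auto simp: P'_def add.commute)
  finally have eq: "shear i0 (\<lambda>i. if i = k then 1 else 0) 1 f - f = \<dots>" .
  have "(\<Sum>x\<in>P - P'. Const (a x) * basis_poly i0 (T x)) \<in> power_ideal q"
    by (intro power_ideal_sum power_ideal_mult basis_poly_in_power_ideal) (auto simp: P'_def not_less)
  from power_ideal_diff[OF inv[unfolded eq] this]
  have "(\<Sum>x\<in>P'. Const (a x) * basis_poly i0 (T x)) \<in> power_ideal q" by simp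
  also have "(\<Sum>x\<in>P'. Const (a x) * basis_poly i0 (T x)) =
      (\<Sum>\<nu>\<in>?E. \<Sum>x\<in>{x\<in>P'. T x = \<nu>}. Const (a x) * basis_poly i0 (T x))"
    using fin(2) T_in by (intro sum.group[symmetric]) (auto simp: finite_exponents)
  also have "\<dots> = (\<Sum>\<nu>\<in>?E. Const (\<Sum>x\<in>{x\<in>P'. T x = \<nu>}. a x) * basis_poly i0 \<nu>)"
    by (intro sum.cong) (simp_all add: Const_sum sum_distrib_right)
  finally have rel: "(\<Sum>x\<in>{x\<in>P'. T x = \<nu>}. a x) = 0" if "\<nu> \<in> ?E" for \<nu>
    using basis_poly_independent[where c = "\<lambda>\<nu>. \<Sum>x\<in>{x\<in>P'. T x = \<nu>}. a x", OF subset_refl _ that]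
    by blast
  show ?thesis
    using \<mu>
  proof (induction "\<mu> i0" arbitrary: \<mu> rule: less_induct)
    case less
    let ?r = "\<mu> k mod ?p"
    have r: "0 < ?r" "?r < ?p"
      using less.prems(2) by (simp_all add: mod_greater_zero_iff_not_dvd)
    then have "0 < \<mu> k" by (metis mod_0 not_gr_zero)
    \<comment> \<open>The hypothesis \<open>Suc (\<mu> i0) < q\<close> is what keeps the target of
      this step out of the ideal.\<close>
    have mem: "(\<mu>, 1) \<in> P'"
      using less.prems r k by (simp add: P'_def P_def T_def)
    have "a x = 0" if x: "x \<in> {x \<in> P'. T x = T (\<mu>, 1)} - {(\<mu>, 1)}" for x
    proof -
      obtain \<nu> j where x_eq: "x = (\<nu>, j)" by (cases x)
      then have xj: "x = (\<nu>, j)" "\<nu> \<in> ?E" "1 \<le> j" "j \<le> \<nu> k mod ?p" and T: "T (\<nu>, j) = T (\<mu>, 1)"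
        and ne: "(\<nu>, j) \<noteq> (\<mu>, 1)"
        using x by (simp_all add: P'_def P_def)
      have i0: "\<nu> i0 + j = \<mu> i0 + 1" using fun_cong[OF T, of i0] by (simp add: T_def)
      have kk: "\<nu> k - j = \<mu> k - 1" using fun_cong[OF T, of k] k by (simp add: T_def)
      have "j \<le> \<nu> k" using xj(4) mod_less_eq_dividend order_trans by blast
      have "j \<noteq> 1"
      proof
        assume "j = 1"
        have "\<nu> = \<mu>"
        proof
          fix i show "\<nu> i = \<mu> i"
            using fun_cong[OF T, of i] i0 kk \<open>j = 1\<close> \<open>j \<le> \<nu> k\<close> \<open>0 < \<mu> k\<close> k
            by (auto simp: T_def split: if_splits)
        qed
        with ne \<open>j = 1\<close> show False by simp
      qed
      \<comment> \<open>Here j is at least 2, so \<open>\<nu> i0 + j = \<mu> i0 + 1\<close> forces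
        the decrease; moreover \<open>\<nu> k mod ?p\<close> is at least j, so the induction
        hypothesis applies.\<close>
      with xj i0 have "\<nu> i0 < \<mu> i0" by linarith
      moreover have "\<not> ?p dvd \<nu> k"
        using xj(3,4) by (simp add: dvd_eq_mod_eq_0)
      ultimately have "c \<nu> = 0" using xj(2) less.prems(3) by (intro less.hyps) simp_all
      then show ?thesis by (simp add: xj(1) a_def)
    qed
    then have "(\<Sum>x\<in>{x\<in>P'. T x = T (\<mu>, 1)}. a x) = a (\<mu>, 1)"
      using mem fin(2) by (subst sum.remove[of _ "(\<mu>, 1)"]) simp_all
    with rel[OF T_in[OF mem]] have "c \<mu> * of_nat ?r = 0" by (simp add: a_def)
    \<comment> \<open>The remainder lies strictly between 0 and p, so it is a unit in the
      field.\<close>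
    moreover have "(of_nat ?r :: 'p mod_ring) \<noteq> 0"
      using r of_nat_0_mod_ring_dvd[where 'a='p, of ?r] nat_dvd_not_less by blast
    ultimately show ?case by simp
  qed
qed

section \<open>Groups fixing a hyperplane\<close>

lemma group_GL: "Group.group (GL :: ('a::field ^ 'n ^ 'n) monoid)"
proof (rule groupI)
  fix x :: "'a ^ 'n ^ 'n" assume "x \<in> carrier GL"
  then obtain y where "x ** y = mat 1" "y ** x = mat 1" by (auto simp: GL_def invertible_def)
  then show "\<exists>y\<in>carrier GL. y \<otimes>\<^bsub>GL\<^esub> x = \<one>\<^bsub>GL\<^esub>"
    by (auto simp: GL_def invertible_def)
qed (auto simp: GL_def invertible_mult matrix_mul_assoc, auto simp: invertible_def)

lemma GL_simps [simp]:
  "carrier GL = {A. invertible A}" "x \<otimes>\<^bsub>GL\<^esub> y = x ** y" "\<one>\<^bsub>GL\<^esub> = mat 1"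
  by (simp_all add: GL_def)

text \<open>Extend a basis of U to one of H and span the added vectors; the dimension formula makes
  the intersection trivial. A complement inside H is wanted because group elements fix H
  pointwise.\<close>

lemma subspace_complement_within:
  fixes U H :: "('a::field ^ 'n) set"
  assumes "vec.subspace U" "vec.subspace H" "U \<subseteq> H"
  obtains W where "vec.subspace W" "W \<subseteq> H" "U \<inter> W = {0}" "\<And>v. v \<in> H \<Longrightarrow> \<exists>u\<in>U. \<exists>w\<in>W. v = u + w"
proof -
  obtain A where A: "A \<subseteq> U" "vec.independent A" "U \<subseteq> vec.span A"
    using vec.maximal_independent_subset by blast
  then obtain B where B: "A \<subseteq> B" "B \<subseteq> H" "vec.independent B" "H \<subseteq> vec.span B"
    using vec.maximal_independent_subset_extend[of A H] assms(3) by blast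
  have U: "vec.span A = U" and H: "vec.span B = H"
    using A B assms by (auto simp: vec.span_minimal subset_antisym)
  let ?W = "vec.span (B - A)"
  have "?W \<subseteq> H" using B assms(2) by (intro vec.span_minimal) auto
  have sums: "{u + w |u w. u \<in> U \<and> w \<in> ?W} = H"
    using vec.span_Un[of A "B - A"] B(1) unfolding U H[symmetric] by (auto simp: Un_absorb1 image_iff)
  have "vec.dim (U \<inter> ?W) = 0"
  proof -
    have fin: "finite B" using B(3) by (rule vec.finiteI_independent)
    have "vec.independent (B - A)" using B(3) by (rule vec.independent_mono) auto
    then have "vec.dim ?W = card (B - A)" "vec.dim U = card A" "vec.dim H = card B"
      using A(2) B(3) unfolding U[symmetric] H[symmetric] by (simp_all add: vec.dim_eq_card_independent)
    moreover have "card B = card A + card (B - A)"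
      using fin B(1) by (simp add: card_Diff_subset finite_subset card_mono)
    ultimately show ?thesis
      using vec.dim_sums_Int[OF assms(1) vec.subspace_span[of "B - A"]] unfolding sums by simp
  qed
  then have "U \<inter> ?W = {0}"
    using assms(1) by (auto simp: vec.dim_eq_0 vec.subspace_0 vec.span_zero)
  with \<open>?W \<subseteq> H\<close> sums show ?thesis
    by (intro that[of ?W]) (auto simp: vec.subspace_span)
qed

lemma semisimple_mat_1: "semisimple (mat 1 :: 'a::field ^ 'n ^ 'n)"
  unfolding semisimple_def
proof (intro allI impI)
  fix U :: "('a ^ 'n) set"
  assume "vec.subspace U \<and> (\<forall>u\<in>U. mat 1 *v u \<in> U)"
  then obtain W where W: "vec.subspace W" "U \<inter> W = {0}" "\<And>v. \<exists>u\<in>U. \<exists>w\<in>W. v = u + w"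
    using subspace_complement_within[of U UNIV] by (metis vec.subspace_UNIV subset_UNIV UNIV_I)
  then show "\<exists>W. vec.subspace W \<and> (\<forall>w\<in>W. mat 1 *v w \<in> W) \<and> U \<inter> W = {0} \<and> (\<forall>v. \<exists>u\<in>U. \<exists>w\<in>W. v = u + w)"
    by (intro exI[of _ W]) simp
qed

locale hyperplane_group = l: Vector_Spaces.linear "(*s)" "(*)" l for l :: "'a::field ^ 'n \<Rightarrow> 'a" +
  fixes G :: "('a ^ 'n ^ 'n) set"
  assumes subgroup_G: "subgroup G GL"
    and fixes_kernel: "g \<in> G \<Longrightarrow> l v = 0 \<Longrightarrow> g *v v = v"
    and l_nonzero: "\<exists>u. l u \<noteq> 0"
begin

abbreviation "R \<equiv> root_space l G"

lemma subspace_kernel: "vec.subspace {v. l v = 0}"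
  by (auto simp: vec.subspace_def l.add l.scale l.zero)

lemma root_exists:
  assumes "g \<in> G"
  obtains \<alpha> where "\<alpha> \<in> R" "\<forall>v. g *v v = v + l v *s \<alpha>"
proof -
  obtain u where u: "l u \<noteq> 0" using l_nonzero by blast
  \<comment> \<open>The value at u forces this choice. Since \<open>?h\<close> below lies in the
    kernel and is fixed, g is determined by its value at u.\<close>
  define \<alpha> where "\<alpha> = inverse (l u) *s (g *v u - u)"
  have \<alpha>: "g *v v = v + l v *s \<alpha>" for v
  proof -
    let ?h = "v - (l v / l u) *s u"
    have "l ?h = 0" using u by (simp add: l.diff l.scale)
    then have "g *v ?h = ?h" by (rule fixes_kernel[OF assms])
    then have "g *v v - (l v / l u) *s (g *v u) = v - (l v / l u) *s u"
      by (simp add: matrix_vector_mult_diff_distrib vec.scale)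
    then have "g *v v = v - (l v / l u) *s u + (l v / l u) *s (g *v u)"
      by (simp add: diff_eq_eq)
    also have "\<dots> = v + l v *s \<alpha>"
      by (simp add: \<alpha>_def vec.scale_right_diff_distrib divide_inverse)
    finally show ?thesis .
  qed
  then have "\<alpha> \<in> R" using assms by (auto simp: root_space_def)
  then show ?thesis using \<alpha> by (intro that[of \<alpha>]) auto
qed

lemma rootE:
  assumes "\<alpha> \<in> R"
  obtains g where "g \<in> G" "\<forall>v. g *v v = v + l v *s \<alpha>"
  using assms unfolding root_space_def by blast

lemma zero_root: "0 \<in> R"
  using subgroup.one_closed[OF subgroup_G] by (auto simp: root_space_def intro: bexI[of _ "mat 1"])

text \<open>This is the root of a product of two elements. Applying \<open>1 + l\<close> to it shows
  that eigenvalues multiply; for \<open>l \<beta> = 0\<close> it reduces to addition of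
  roots.\<close>

lemma root_compose:
  assumes "\<alpha> \<in> R" "\<beta> \<in> R"
  shows "\<beta> + (1 + l \<beta>) *s \<alpha> \<in> R"
proof -
  obtain g where g: "g \<in> G" "\<forall>v. g *v v = v + l v *s \<alpha>" using assms(1) by (rule rootE)
  obtain h where h: "h \<in> G" "\<forall>v. h *v v = v + l v *s \<beta>" using assms(2) by (rule rootE)
  have "g ** h \<in> G" using subgroup.m_closed[OF subgroup_G g(1) h(1)] by simp
  moreover have "(g ** h) *v v = v + l v *s (\<beta> + (1 + l \<beta>) *s \<alpha>)" for v
    by (simp add: g(2) h(2) l.add l.scale vec.scale_right_distrib vec.scale_left_distrib algebra_simps
        flip: matrix_vector_mul_assoc)
  ultimately show ?thesis by (auto simp: root_space_def)
qed

lemma root_add: "\<alpha> \<in> R \<Longrightarrow> \<beta> \<in> R \<Longrightarrow> l \<beta> = 0 \<Longrightarrow> \<alpha> + \<beta> \<in> R"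
  using root_compose[of \<alpha> \<beta>] by (simp add: add.commute)

text \<open>The root is sent to \<open>1 + l \<alpha>\<close> times itself, and an invertible matrix
  kills no nonzero vector.\<close>

lemma root_eigenvalue_nonzero:
  assumes "\<alpha> \<in> R"
  shows "1 + l \<alpha> \<noteq> 0"
proof
  assume *: "1 + l \<alpha> = 0"
  obtain g where g: "g \<in> G" "\<forall>v. g *v v = v + l v *s \<alpha>" using assms by (rule rootE)
  have "g *v \<alpha> = (1 + l \<alpha>) *s \<alpha>" using g(2) by (simp add: vec.scale_left_distrib)
  with * have "g *v \<alpha> = 0" by simp
  moreover have "invertible g" using subgroup.subset[OF subgroup_G] g(1) by auto
  then obtain h where "h ** g = mat 1" by (auto simp: invertible_def)
  ultimately have "\<alpha> = 0" by (metis matrix_vector_mul_assoc matrix_vector_mul_lid matrix_vector_mult_0_right)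
  with * show False by (simp add: l.zero)
qed

text \<open>Each application of g multiplies the value of l by \<open>1 + l \<alpha>\<close>, so the
  displacements along the root add up to a geometric sum.\<close>

lemma pow_mult_vec:
  assumes "\<And>v. g *v v = v + l v *s \<alpha>"
  shows "(g [^]\<^bsub>GL\<^esub> (k::nat)) *v v = v + (l v * (\<Sum>j<k. (1 + l \<alpha>) ^ j)) *s \<alpha>"
proof (induction k arbitrary: v)
  case 0
  then show ?case by (simp add: nat_pow_def)
next
  case (Suc k)
  have "(g [^]\<^bsub>GL\<^esub> Suc k) *v v = (g [^]\<^bsub>GL\<^esub> k) *v (g *v v)"
    by (simp add: matrix_vector_mul_assoc nat_pow_def)
  also have "\<dots> = v + l v *s \<alpha> + (l (v + l v *s \<alpha>) * (\<Sum>j<k. (1 + l \<alpha>) ^ j)) *s \<alpha>"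
    by (simp only: Suc.IH assms)
  also have "l (v + l v *s \<alpha>) = l v * (1 + l \<alpha>)"
    by (simp add: l.add l.scale algebra_simps)
  also have "v + l v *s \<alpha> + (l v * (1 + l \<alpha>) * (\<Sum>j<k. (1 + l \<alpha>) ^ j)) *s \<alpha> =
      v + (l v * (1 + (1 + l \<alpha>) * (\<Sum>j<k. (1 + l \<alpha>) ^ j))) *s \<alpha>"
    by (simp add: distrib_left mult.assoc vec.scale_left_distrib)
  also have "1 + (1 + l \<alpha>) * (\<Sum>j<k. (1 + l \<alpha>) ^ j) = (\<Sum>j<Suc k. (1 + l \<alpha>) ^ j)"
    by (subst sum.lessThan_Suc_shift) (simp add: sum_distrib_left)
  finally show ?case .
qed

lemma pow_eq_one_iff:
  assumes g: "\<And>v. g *v v = v + l v *s \<alpha>" and "l \<alpha> \<noteq> 0"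
  shows "g [^]\<^bsub>GL\<^esub> (k::nat) = \<one>\<^bsub>GL\<^esub> \<longleftrightarrow> (1 + l \<alpha>) ^ k = 1"
proof -
  let ?s = "\<Sum>j<k. (1 + l \<alpha>) ^ j"
  have geom: "(1 + l \<alpha>) ^ k - 1 = l \<alpha> * ?s"
    using power_diff_1_eq[of "1 + l \<alpha>" k] by simp
  obtain u where u: "l u \<noteq> 0" using l_nonzero by blast
  have "\<alpha> \<noteq> 0" using assms(2) l.zero by auto
  have "g [^]\<^bsub>GL\<^esub> k = \<one>\<^bsub>GL\<^esub> \<longleftrightarrow> (\<forall>v. (l v * ?s) *s \<alpha> = 0)"
    by (simp add: matrix_eq pow_mult_vec[OF g])
  also have "\<dots> \<longleftrightarrow> ?s = 0"
    using u \<open>\<alpha> \<noteq> 0\<close> by (auto simp: vec.scale_eq_0_iff)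
  also have "\<dots> \<longleftrightarrow> (1 + l \<alpha>) ^ k = 1" using geom assms(2) by auto
  finally show ?thesis .
qed

text \<open>The space is the direct sum of the fixed hyperplane and the line of the root. An
  invariant subspace lies in the hyperplane or contains the root, as
  \<open>g *v u - u = l u *s \<alpha>\<close>; a complement of its part in the hyperplane, extended
  by the root line in the first case, is invariant.\<close>

lemma semisimple_reflection:
  assumes g: "\<And>v. g *v v = v + l v *s \<alpha>" and "l \<alpha> \<noteq> 0"
  shows "semisimple g"
  unfolding semisimple_def
proof (intro allI impI, elim conjE)
  fix U assume U: "vec.subspace U" "\<forall>u\<in>U. g *v u \<in> U"
  let ?H = "{v. l v = 0}"
  obtain W0 where W0: "vec.subspace W0" "W0 \<subseteq> ?H" "(U \<inter> ?H) \<inter> W0 = {0}"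
      "\<And>v. v \<in> ?H \<Longrightarrow> \<exists>u\<in>U \<inter> ?H. \<exists>w\<in>W0. v = u + w"
    using subspace_complement_within[OF vec.subspace_inter[OF U(1) subspace_kernel] subspace_kernel] by blast
  have split: "\<exists>u\<in>U \<inter> ?H. \<exists>w\<in>W0. \<exists>c. v = u + w + c *s \<alpha>" for v
  proof -
    have "l (v - (l v / l \<alpha>) *s \<alpha>) = 0" using assms(2) by (simp add: l.diff l.scale)
    then obtain u w where "u \<in> U \<inter> ?H" "w \<in> W0" "v - (l v / l \<alpha>) *s \<alpha> = u + w"
      using W0(4) by blast
    then show ?thesis by (metis diff_eq_eq)
  qed
  show "\<exists>W. vec.subspace W \<and> (\<forall>w\<in>W. g *v w \<in> W) \<and> U \<inter> W = {0} \<and> (\<forall>v. \<exists>u\<in>U. \<exists>w\<in>W. v = u + w)"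
  proof (cases "U \<subseteq> ?H")
    case True
    let ?W = "{w + c | w c. w \<in> W0 \<and> c \<in> vec.span {\<alpha>}}"
    have mem: "w + c *s \<alpha> \<in> ?W" if "w \<in> W0" for w c
      using that by (auto simp: vec.span_singleton)
    have "vec.subspace ?W" using W0(1) by (intro vec.subspace_sums vec.subspace_span)
    moreover have "g *v x \<in> ?W" if xW: "x \<in> ?W" for x
    proof -
      obtain w c where x: "x = w + c *s \<alpha>" "w \<in> W0" using xW by (auto simp: vec.span_singleton)
      then have "l w = 0" using W0(2) by auto
      then have "g *v x = w + (c + c * l \<alpha>) *s \<alpha>"
        by (simp add: x(1) g l.add l.scale vec.scale_left_distrib add.assoc)
      then show ?thesis using mem[OF x(2)] by (simp only:)
    qed
    moreover have "U \<inter> ?W = {0}"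
    proof -
      have "x = 0" if xU: "x \<in> U" and xW: "x \<in> ?W" for x
      proof -
        obtain w c where x: "x = w + c *s \<alpha>" "w \<in> W0" using xW by (auto simp: vec.span_singleton)
        have "l x = 0" "l w = 0" using True xU x(2) W0(2) by auto
        then have "c = 0" using assms(2) by (simp add: x(1) l.add l.scale)
        then show ?thesis using x xU True W0(3) by auto
      qed
      moreover have "0 \<in> U" "0 \<in> ?W"
        using U(1) \<open>vec.subspace ?W\<close> vec.subspace_0 by blast+
      ultimately show ?thesis by blast
    qed
    moreover have "\<exists>u\<in>U. \<exists>w\<in>?W. v = u + w" for v
    proof -
      obtain u w c where "u \<in> U" "w \<in> W0" "v = u + w + c *s \<alpha>" using split[of v] by blast
      then show ?thesis
        by (intro bexI[of _ u] bexI[of _ "w + c *s \<alpha>"] mem) (simp_all add: add.assoc)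
    qed
    ultimately show ?thesis by (intro exI[of _ ?W] conjI ballI allI)
  next
    case False
    then obtain u where u: "u \<in> U" "l u \<noteq> 0" by auto
    have "g *v u - u \<in> U" using u U by (intro vec.subspace_diff) auto
    then have "inverse (l u) *s (g *v u - u) \<in> U" by (rule vec.subspace_scale[OF U(1)])
    then have \<alpha>: "\<alpha> \<in> U" using u(2) by (simp add: g)
    have "\<exists>u\<in>U. \<exists>w\<in>W0. v = u + w" for v
    proof -
      obtain u' w c where "u' \<in> U" "w \<in> W0" "v = u' + w + c *s \<alpha>" using split[of v] by blast
      moreover have "u' + c *s \<alpha> \<in> U"
        using \<open>u' \<in> U\<close> \<alpha> U(1) by (intro vec.subspace_add vec.subspace_scale)
      ultimately show ?thesis
        by (intro bexI[of _ "u' + c *s \<alpha>"] bexI[of _ w]) (simp_all add: algebra_simps)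
    qed
    moreover have "g *v w \<in> W0" if "w \<in> W0" for w
    proof -
      have "l w = 0" using that W0(2) by auto
      then show ?thesis using that by (simp add: g)
    qed
    moreover have "U \<inter> W0 = {0}" using W0(2,3) by blast
    ultimately show ?thesis using W0(1) by blast
  qed
qed

text \<open>A nonzero root with \<open>l \<alpha> = 0\<close> spans an invariant line without
  invariant complement: a complement would contain some w outside the hyperplane, hence
  \<open>g *v w - w\<close>, a nonzero multiple of the root.\<close>

lemma semisimple_transvection:
  assumes g: "\<And>v. g *v v = v + l v *s \<alpha>" and "l \<alpha> = 0" "semisimple g"
  shows "g = mat 1"
proof -
  have "\<alpha> = 0"
  proof (rule ccontr)
    assume "\<alpha> \<noteq> 0"
    let ?U = "vec.span {\<alpha>}"
    have lU: "l u = 0" if "u \<in> ?U" for u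
      using that assms(2) by (auto simp: vec.span_singleton l.scale)
    have "\<forall>u\<in>?U. g *v u \<in> ?U"
    proof
      fix u assume "u \<in> ?U"
      moreover from this have "g *v u = u" using g[of u] lU by simp
      ultimately show "g *v u \<in> ?U" by (simp only:)
    qed
    then obtain W where W: "vec.subspace W" "\<forall>w\<in>W. g *v w \<in> W" "?U \<inter> W = {0}"
        "\<forall>v. \<exists>u\<in>?U. \<exists>w\<in>W. v = u + w"
      using assms(3)[unfolded semisimple_def, THEN spec[of _ ?U]] vec.subspace_span[of "{\<alpha>}"]
      by (elim impE exE conjE) simp_all
    obtain x where x: "l x \<noteq> 0" using l_nonzero by blast
    obtain u w where "u \<in> ?U" "w \<in> W" "x = u + w" using W(4) by blast
    then have w: "w \<in> W" "l w \<noteq> 0" using x lU by (auto simp: l.add)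
    have "g *v w - w \<in> W" using w W by (intro vec.subspace_diff) auto
    then have "inverse (l w) *s (g *v w - w) \<in> W" by (rule vec.subspace_scale[OF W(1)])
    then have "\<alpha> \<in> W" using w(2) by (simp add: g)
    moreover have "\<alpha> \<in> ?U" by (simp add: vec.span_base)
    ultimately show False using W(3) \<open>\<alpha> \<noteq> 0\<close> by blast
  qed
  then show ?thesis using g by (simp add: matrix_eq)
qed

end

section \<open>Eigenvalues, the root space and the number e\<close>

lemma type_ring_pow: "a [^]\<^bsub>ring_of_type_algebra\<^esub> (k::nat) = (a::'a::ring_1) ^ k"
  by (induction k) (simp_all add: nat_pow_def power_commutes)

text \<open>Take a generator of the multiplicative group of the field and its least positive power
  lying in the set; division with remainder shows that this power generates.\<close>

lemma mod_ring_submonoid_cyclic: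
  fixes \<Lambda> :: "'p::prime_card mod_ring set"
  assumes one: "1 \<in> \<Lambda>" and mult: "\<And>x y. x \<in> \<Lambda> \<Longrightarrow> y \<in> \<Lambda> \<Longrightarrow> x * y \<in> \<Lambda>" and "0 \<notin> \<Lambda>"
  obtains \<eta> where "\<eta> \<in> \<Lambda>" "\<And>x. x \<in> \<Lambda> \<Longrightarrow> \<exists>k. x = \<eta> ^ k"
proof -
  let ?F = "ring_of_type_algebra :: 'p mod_ring ring"
  let ?N = "CARD('p) - 1"
  have N: "?N > 0" using prime_gt_1_nat[OF prime_card[where 'a='p]] by simp
  obtain \<gamma> where "\<gamma> \<in> carrier (Multiplicative_Group.mult_of ?F)"
    and "carrier (Multiplicative_Group.mult_of ?F) = {\<gamma> [^]\<^bsub>?F\<^esub> i |i::nat. i \<in> UNIV}"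
    using field.finite_field_mult_group_has_gen[OF field_from_type_algebra, where 'a1 = "'p mod_ring"] by auto
  then have \<gamma>: "\<gamma> \<noteq> 0" and gen: "x \<noteq> 0 \<Longrightarrow> \<exists>i. x = \<gamma> ^ i" for x
    by (auto simp: type_ring_pow set_eq_iff)
  have pow: "x ^ k \<in> \<Lambda>" if "x \<in> \<Lambda>" for x k
    using that by (induction k) (simp_all add: one mult)
  define t where "t = (LEAST i. 0 < i \<and> \<gamma> ^ i \<in> \<Lambda>)"
  have "0 < ?N \<and> \<gamma> ^ ?N \<in> \<Lambda>" using N one mod_ring_power_card_minus_1[OF \<gamma>] by simp
  then have t: "0 < t" "\<gamma> ^ t \<in> \<Lambda>"
    unfolding t_def using LeastI[of "\<lambda>i. 0 < i \<and> \<gamma> ^ i \<in> \<Lambda>"] by blast+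
  show ?thesis
  proof (rule that[OF t(2)])
    fix x assume x: "x \<in> \<Lambda>"
    then obtain i where i: "x = \<gamma> ^ i" using gen assms(3) by metis
    let ?\<eta> = "(\<gamma> ^ t) ^ (i div t)"
    have "\<gamma> ^ i = \<gamma> ^ (t * (i div t) + i mod t)" by simp
    then have eq: "x = ?\<eta> * \<gamma> ^ (i mod t)" unfolding i power_add power_mult .
    \<comment> \<open>Since \<open>?\<eta> ^ ?N = 1\<close>, the factor
      \<open>?\<eta> ^ (?N - 1)\<close> is an inverse of \<open>?\<eta>\<close> that stays in the
      set, so closure under products suffices.\<close>
    have "?\<eta> ^ (?N - 1) * x = ?\<eta> ^ Suc (?N - 1) * \<gamma> ^ (i mod t)"
      by (subst eq) (simp add: mult_ac)
    also have "Suc (?N - 1) = ?N" using N by simp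
    also have "?\<eta> ^ ?N = 1" using mod_ring_power_card_minus_1[of ?\<eta>] \<gamma> by simp
    finally have "\<gamma> ^ (i mod t) \<in> \<Lambda>"
      using mult[OF pow[OF pow[OF t(2)]] x] by (metis mult_1)
    moreover have "i mod t < t" using t(1) by simp
    ultimately have "i mod t = 0"
      unfolding t_def using not_less_Least[of "i mod t" "\<lambda>i. 0 < i \<and> \<gamma> ^ i \<in> \<Lambda>"]
      by (auto simp: t_def)
    then show "\<exists>k. x = (\<gamma> ^ t) ^ k" using eq by auto
  qed
qed

text \<open>The roots in the kernel are closed under addition, and over a prime field every scalar
  is a natural number, so they form a subspace; equality then follows from the dimension.\<close>

lemma kernel_subset_root_space:
  fixes l :: "'p::prime_card mod_ring ^ 'n \<Rightarrow> 'p mod_ring"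
  assumes "hyperplane_group l G"
    and "vec.dim {v. l v = 0} \<le> vec.dim (root_space l G \<inter> {v. l v = 0})"
  shows "{v. l v = 0} \<subseteq> root_space l G"
proof -
  interpret hyperplane_group l G by fact
  let ?T = "R \<inter> {v. l v = 0}"
  have add: "x + y \<in> ?T" if "x \<in> ?T" "y \<in> ?T" for x y
    using that root_add by (simp add: l.add)
  have zero: "0 \<in> ?T" using zero_root by (simp add: l.zero)
  have "c *s x \<in> ?T" if "x \<in> ?T" for c x
  proof -
    have "of_nat k *s x \<in> ?T" for k
    proof (induction k)
      case (Suc k)
      with add[OF that] show ?case by (simp add: vec.scale_left_distrib)
    qed (use zero in simp)
    then show ?thesis using surj_of_nat_mod_ring[of c] by auto
  qed
  then have "vec.subspace ?T" using add zero by (intro vec.subspaceI)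
  then have "?T = {v. l v = 0}"
    using subspace_kernel assms(2) by (intro vec.subspace_dim_equal) auto
  then show ?thesis by blast
qed

text \<open>The eigenvalues \<open>1 + l \<alpha>\<close> form a cyclic group. A semisimple element
  is the identity or has \<open>l \<alpha> \<noteq> 0\<close>, and then its order is that of its
  eigenvalue; so e is the order of a generator.\<close>

lemma max_semisimple_order_dvd_iff:
  fixes l :: "'p::prime_card mod_ring ^ 'n \<Rightarrow> 'p mod_ring"
  assumes "hyperplane_group l G" and e: "e = Max (group.ord GL ` {g \<in> G. semisimple g})"
  shows "e dvd k \<longleftrightarrow> (\<forall>\<alpha>\<in>root_space l G. (1 + l \<alpha>) ^ k = 1)"
proof -
  interpret hyperplane_group l G by fact
  interpret GL: Group.group "GL :: ('p mod_ring ^ 'n ^ 'n) monoid" by (rule group_GL)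
  have inG: "g \<in> carrier GL" if "g \<in> G" for g using subgroup.subset[OF subgroup_G] that by blast
  define \<Lambda> where "\<Lambda> = (\<lambda>\<alpha>. 1 + l \<alpha>) ` R"
  have "1 \<in> \<Lambda>" unfolding \<Lambda>_def using zero_root by (intro image_eqI[of _ _ 0]) (simp_all add: l.zero)
  moreover have "x * y \<in> \<Lambda>" if xy: "x \<in> \<Lambda>" "y \<in> \<Lambda>" for x y
  proof -
    obtain \<alpha> \<beta> where "\<alpha> \<in> R" "\<beta> \<in> R" "x = 1 + l \<alpha>" "y = 1 + l \<beta>" using xy by (auto simp: \<Lambda>_def)
    then show ?thesis
      unfolding \<Lambda>_def by (intro image_eqI[OF _ root_compose[of \<alpha> \<beta>]]) (simp_all add: l.add l.scale algebra_simps)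
  qed
  moreover have "0 \<notin> \<Lambda>" using root_eigenvalue_nonzero by (force simp: \<Lambda>_def)
  ultimately obtain \<eta> where \<eta>: "\<eta> \<in> \<Lambda>" and gen: "\<And>x. x \<in> \<Lambda> \<Longrightarrow> \<exists>k. x = \<eta> ^ k"
    using mod_ring_submonoid_cyclic[of \<Lambda>] by metis
  obtain \<beta> where \<beta>: "\<beta> \<in> R" "\<eta> = 1 + l \<beta>" using \<eta> by (auto simp: \<Lambda>_def)
  have all: "(\<forall>\<alpha>\<in>R. (1 + l \<alpha>) ^ k = 1) \<longleftrightarrow> \<eta> ^ k = 1" for k
  proof
    assume "\<eta> ^ k = 1"
    then have "x ^ k = 1" if "x \<in> \<Lambda>" for x
      using gen[OF that] by (metis power_commutes power_mult mult.commute power_one)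
    then show "\<forall>\<alpha>\<in>R. (1 + l \<alpha>) ^ k = 1" by (auto simp: \<Lambda>_def)
  qed (use \<beta> in auto)
  let ?S = "{g \<in> G. semisimple g}"
  have one: "mat 1 \<in> ?S" using subgroup.one_closed[OF subgroup_G] semisimple_mat_1 by simp
  have ord1: "GL.ord (mat 1) = 1" using GL.ord_id by simp
  have "e dvd k \<longleftrightarrow> \<eta> ^ k = 1" for k
  proof (cases "\<eta> = 1")
    \<comment> \<open>If all eigenvalues are 1, the identity is the only semisimple element and e is
      1.\<close>
    case True
    have "g = mat 1" if "g \<in> ?S" for g
    proof -
      obtain \<alpha> where \<alpha>: "\<alpha> \<in> R" "\<forall>v. g *v v = v + l v *s \<alpha>" using root_exists[of g] \<open>g \<in> ?S\<close> by auto
      have "l \<alpha> = 0" using all[of 1] True \<alpha>(1) by simp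
      then show ?thesis using semisimple_transvection[of g \<alpha>] \<alpha>(2) that by simp
    qed
    then have "?S = {mat 1}" using one by blast
    then show ?thesis using True ord1 by (simp add: e)
  next
    case False
    obtain h where h: "h \<in> G" "\<forall>v. h *v v = v + l v *s \<beta>" using \<beta>(1) by (rule rootE)
    have "l \<beta> \<noteq> 0" using False \<beta>(2) by simp
    have "h \<in> ?S" using h \<open>l \<beta> \<noteq> 0\<close> semisimple_reflection[of h \<beta>] by simp
    have dvd: "GL.ord h dvd k \<longleftrightarrow> \<eta> ^ k = 1" for k
      using GL.pow_eq_id[OF inG[OF h(1)], of k] pow_eq_one_iff[of h \<beta> k] h(2) \<open>l \<beta> \<noteq> 0\<close> \<beta>(2) by simp
    \<comment> \<open>Matrices over a finite field have finite order; positivity is what turns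
      divisibility of orders into an inequality.\<close>
    have pos: "0 < GL.ord h"
      using GL.ord_ge_1[OF _ inG[OF h(1)]] by simp
    \<comment> \<open>The element h realises the generating eigenvalue, so every order in the set
      divides its order.\<close>
    have "Max (group.ord GL ` ?S) = GL.ord h"
    proof (rule Max_eqI)
      fix y assume "y \<in> group.ord GL ` ?S"
      then obtain g where g: "g \<in> G" "semisimple g" "y = GL.ord g" by auto
      obtain \<alpha> where \<alpha>: "\<alpha> \<in> R" "\<forall>v. g *v v = v + l v *s \<alpha>" using root_exists[OF g(1)] by auto
      show "y \<le> GL.ord h"
      proof (cases "l \<alpha> = 0")
        case True
        then have "g = mat 1" using semisimple_transvection[of g \<alpha>] \<alpha>(2) g(2) by simp
        then show ?thesis using pos ord1 by (simp add: g(3))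
      next
        case False
        have "(1 + l \<alpha>) ^ GL.ord h = 1" using all[of "GL.ord h"] dvd[of "GL.ord h"] \<alpha>(1) by simp
        then have "g [^]\<^bsub>GL\<^esub> GL.ord h = \<one>\<^bsub>GL\<^esub>" using pow_eq_one_iff[of g \<alpha>] \<alpha>(2) False by simp
        then have "GL.ord g dvd GL.ord h" using GL.pow_eq_id[OF inG[OF g(1)]] by blast
        then show ?thesis using pos by (simp add: g(3) dvd_imp_le)
      qed
    qed (use \<open>h \<in> ?S\<close> in auto)
    then show ?thesis using dvd by (simp add: e)
  qed
  then show ?thesis using all by simp
qed

section \<open>Counting exponents\<close>

text \<open>Reads each quotient in the Hilbert series as the generating function of the multiples of
  a below N.\<close>

lemma fps_divide_geometric:
  assumes "0 < a" "a dvd N"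
  shows "(1 - fps_X ^ N) / (1 - fps_X ^ a) = (\<Sum>k | k < N \<and> a dvd k. fps_X ^ k :: 'k::field fps)"
proof -
  obtain M where N: "N = a * M" using assms(2) by (rule dvdE)
  have "{k. k < N \<and> a dvd k} = (\<lambda>j. a * j) ` {..<M}"
    using assms(1) by (auto simp: N)
  then have "(\<Sum>k | k < N \<and> a dvd k. fps_X ^ k :: 'k fps) = (\<Sum>j<M. (fps_X ^ a) ^ j)"
    using assms(1) by (simp add: sum.reindex inj_on_def power_mult)
  moreover have "1 - fps_X ^ N = (\<Sum>j<M. (fps_X ^ a) ^ j) * (1 - fps_X ^ a :: 'k fps)"
    using one_diff_power_eq[of "fps_X ^ a :: 'k fps" M] by (simp add: N power_mult mult.commute[of "1 - fps_X ^ a"])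
  moreover have "(1 - fps_X ^ a :: 'k fps) \<noteq> 0"
  proof
    assume "(1 - fps_X ^ a :: 'k fps) = 0"
    then have "fps_nth (1 - fps_X ^ a :: 'k fps) 0 = fps_nth 0 0" by (rule arg_cong)
    then show False using assms(1) by simp
  qed
  ultimately show ?thesis by simp
qed

lemma fps_weight_enumerator:
  assumes "finite M"
  shows "Abs_fps (\<lambda>d. of_nat (card {\<mu> \<in> M. w \<mu> = d})) = (\<Sum>\<mu>\<in>M. fps_X ^ w \<mu> :: 'k::comm_ring_1 fps)"
proof (rule fps_ext)
  fix d
  have "(\<Sum>\<mu>\<in>M. if d = w \<mu> then 1 else 0 :: 'k) = of_nat (card {\<mu> \<in> M. w \<mu> = d})"
    using assms by (subst sum.inter_filter[symmetric]) (simp_all add: eq_commute)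
  then show "fps_nth (Abs_fps (\<lambda>d. of_nat (card {\<mu> \<in> M. w \<mu> = d}))) d = fps_nth (\<Sum>\<mu>\<in>M. fps_X ^ w \<mu> :: 'k fps) d"
    by (simp add: fps_sum_nth fps_X_power_nth)
qed

text \<open>The coordinates vary independently and the weight is their sum, so the generating
  function is a product over the coordinates.\<close>

lemma fps_weight_enumerator_PiE:
  fixes i0 :: "'n::finite"
  assumes "finite A" "finite B"
  shows "(\<Sum>\<mu>\<in>PiE UNIV (\<lambda>i. if i = i0 then A else B). fps_X ^ sum \<mu> UNIV :: 'k::comm_ring_1 fps) =
    (\<Sum>k\<in>A. fps_X ^ k) * (\<Sum>k\<in>B. fps_X ^ k) ^ (CARD('n) - 1)"
proof -
  have "(\<Sum>\<mu>\<in>PiE UNIV (\<lambda>i. if i = i0 then A else B). fps_X ^ sum \<mu> UNIV :: 'k fps) =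
      (\<Prod>i\<in>UNIV. \<Sum>k\<in>(if i = i0 then A else B). fps_X ^ k)"
    using assms by (subst prod_sum_PiE) (auto simp: power_sum)
  also have "\<dots> = (\<Sum>k\<in>A. fps_X ^ k) * (\<Prod>i\<in>UNIV - {i0}. \<Sum>k\<in>(if i = i0 then A else B). fps_X ^ k)"
    by (subst prod.remove[of UNIV i0]) simp_all
  also have "(\<Prod>i\<in>UNIV - {i0}. \<Sum>k\<in>(if i = i0 then A else B). fps_X ^ k :: 'k fps) =
      (\<Prod>i\<in>UNIV - {i0}. \<Sum>k\<in>B. fps_X ^ k)"
    by (rule prod.cong) auto
  finally show ?thesis by (simp add: card_Diff_singleton)
qed

text \<open>For \<open>\<mu> i0 = q - 1\<close> divisibility by e is automatic once
  \<open>e dvd q - 1\<close>, so only the other alternative states it.\<close>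

definition invariant_exponents :: "'n \<Rightarrow> nat \<Rightarrow> nat \<Rightarrow> nat \<Rightarrow> nat \<Rightarrow> ('n::finite \<Rightarrow> nat) set" where
  "invariant_exponents i0 p e q d =
     {\<mu> \<in> exponents q d. \<mu> i0 = q - 1 \<or> (\<forall>i. i \<noteq> i0 \<longrightarrow> p dvd \<mu> i) \<and> e dvd \<mu> i0}"

lemma invariant_exponents_generating_function:
  fixes i0 :: "'n::finite"
  assumes "0 < q" "0 < p" "p dvd q" "0 < e" "e dvd q - 1"
  shows "(Abs_fps (\<lambda>d. of_nat (card (invariant_exponents i0 p e q d))) :: 'k::field fps) =
    ((1 - fps_X ^ q) / (1 - fps_X ^ p)) ^ (CARD('n) - 1) * ((1 - fps_X ^ (q - 1)) / (1 - fps_X ^ e)) +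
    fps_X ^ (q - 1) * ((1 - fps_X ^ q) / (1 - fps_X)) ^ (CARD('n) - 1)"
proof -
  \<comment> \<open>Exponents \<open>q - 1\<close> at \<open>i0\<close> are left to
    \<open>?M2\<close>, which makes the sets disjoint and puts \<open>q - 1\<close> into the
    numerator of the first summand. The condition \<open>1 dvd k\<close> in \<open>?M2\<close> fits
    the geometric sum with step 1.\<close>
  let ?M1 = "PiE UNIV (\<lambda>i. if i = i0 then {k. k < q - 1 \<and> e dvd k} else {k. k < q \<and> p dvd k})"
  let ?M2 = "PiE UNIV (\<lambda>i. if i = i0 then {q - 1} else {k. k < q \<and> 1 dvd k})"
  have fin: "finite ?M1" "finite ?M2"
    by (rule finite_PiE; simp)+
  have disj: "?M1 \<inter> ?M2 = {}"
    by (auto simp: PiE_iff split: if_splits)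
  have "invariant_exponents i0 p e q d = {\<mu> \<in> ?M1 \<union> ?M2. sum \<mu> UNIV = d}" for d
  proof (rule Set.set_eqI)
    fix \<mu> :: "'n \<Rightarrow> nat"
    have M1: "\<mu> \<in> ?M1 \<longleftrightarrow> \<mu> i0 < q - 1 \<and> e dvd \<mu> i0 \<and> (\<forall>i. i \<noteq> i0 \<longrightarrow> \<mu> i < q) \<and> (\<forall>i. i \<noteq> i0 \<longrightarrow> p dvd \<mu> i)"
      by (auto simp: PiE_iff split: if_splits)
    have M2: "\<mu> \<in> ?M2 \<longleftrightarrow> \<mu> i0 = q - 1 \<and> (\<forall>i. i \<noteq> i0 \<longrightarrow> \<mu> i < q)"
      by (auto simp: PiE_iff split: if_splits)
    have lt: "(\<forall>i. \<mu> i < q) \<longleftrightarrow> (\<mu> i0 < q - 1 \<or> \<mu> i0 = q - 1) \<and> (\<forall>i. i \<noteq> i0 \<longrightarrow> \<mu> i < q)"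
    proof -
      have "\<mu> i0 < q \<longleftrightarrow> \<mu> i0 < q - 1 \<or> \<mu> i0 = q - 1" using assms(1) by linarith
      then show ?thesis by metis
    qed
    show "\<mu> \<in> invariant_exponents i0 p e q d \<longleftrightarrow> \<mu> \<in> {\<mu> \<in> ?M1 \<union> ?M2. sum \<mu> UNIV = d}"
      unfolding invariant_exponents_def exponents_def mem_Collect_eq Un_iff M1 M2 lt by argo
  qed
  then have "Abs_fps (\<lambda>d. of_nat (card (invariant_exponents i0 p e q d))) =
      (\<Sum>\<mu>\<in>?M1 \<union> ?M2. fps_X ^ sum \<mu> UNIV :: 'k fps)"
    using fin by (simp only: fps_weight_enumerator finite_UnI)
  also have "\<dots> = (\<Sum>\<mu>\<in>?M1. fps_X ^ sum \<mu> UNIV) + (\<Sum>\<mu>\<in>?M2. fps_X ^ sum \<mu> UNIV)"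
    using fin disj by (rule sum.union_disjoint)
  also have "\<dots> = (\<Sum>k | k < q - 1 \<and> e dvd k. fps_X ^ k) * (\<Sum>k | k < q \<and> p dvd k. fps_X ^ k) ^ (CARD('n) - 1) +
      fps_X ^ (q - 1) * (\<Sum>k | k < q \<and> 1 dvd k. fps_X ^ k) ^ (CARD('n) - 1)"
    by (subst (1 2) fps_weight_enumerator_PiE) simp_all
  finally show ?thesis
    using fps_divide_geometric[of e "q - 1", where 'k='k] fps_divide_geometric[of p q, where 'k='k]
      fps_divide_geometric[of 1 q, where 'k='k] assms by (simp add: mult.commute)
qed

section \<open>The invariants\<close>

lemma matrix_inv:
  fixes g :: "'a::field ^ 'n ^ 'n"
  assumes "invertible g"
  shows "g ** matrix_inv g = mat 1" "matrix_inv g ** g = mat 1"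
  using someI_ex[OF assms[unfolded invertible_def]] unfolding matrix_inv_def by auto

lemma matrix_inv_unique:
  fixes g :: "'a::field ^ 'n ^ 'n"
  assumes "h ** g = mat 1" "g ** h = mat 1"
  shows "matrix_inv g = h"
proof -
  have "invertible g" using assms by (auto simp: invertible_def)
  then have "h = h ** (g ** matrix_inv g)" by (simp add: matrix_inv)
  also have "\<dots> = matrix_inv g" by (simp add: matrix_mul_assoc assms)
  finally show ?thesis by simp
qed

lemma act_matrix_inv:
  fixes f :: "('n::finite, 'a::field) mpoly"
  assumes "invertible g"
  shows "act g (act (matrix_inv g) f) = f"
proof (rule alg_hom_eqI[OF alg_hom_comp[OF alg_hom_act alg_hom_act] alg_hom_id])
  fix i :: 'n
  have "matrix_inv (matrix_inv g) = g"
    using matrix_inv[OF assms] by (intro matrix_inv_unique)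
  then have "act g (act (matrix_inv g) (Var i)) = (\<Sum>j\<in>UNIV. \<Sum>k\<in>UNIV. Const (g $ i $ j * matrix_inv g $ j $ k) * Var k)"
    by (simp add: act_eq_subst subst_Var alg_hom_simps[OF alg_hom_subst] Const_mult sum_distrib_left mult.assoc)
  also have "\<dots> = (\<Sum>k\<in>UNIV. \<Sum>j\<in>UNIV. Const (g $ i $ j * matrix_inv g $ j $ k) * Var k)"
    by (rule sum.swap)
  also have "\<dots> = (\<Sum>k\<in>UNIV. Const ((g ** matrix_inv g) $ i $ k) * Var k)"
    by (simp add: matrix_matrix_mult_def Const_sum sum_distrib_right)
  also have "\<dots> = (\<Sum>k\<in>UNIV. if k = i then Var k else 0)"
    unfolding matrix_inv(1)[OF assms] by (intro sum.cong) (auto simp: mat_def)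
  finally show "act g (act (matrix_inv g) (Var i)) = Var i" by simp
qed

lemma homogeneous_act_Var: "act g (Var i) \<in> homogeneous 1"
  unfolding act_eq_subst subst_Var
  by (intro homogeneous_sum homogeneous_Const_mult homogeneous_Var)

text \<open>The ideal is stable under g and under its inverse, so the image of the class of f is the
  whole class of \<open>act g f\<close>.\<close>

lemma act_residue_class_eq_iff:
  fixes f :: "('n::finite, 'p::prime_card mod_ring) mpoly"
  assumes "invertible g"
  shows "act g ` residue_class (CARD('p) ^ m) f = residue_class (CARD('p) ^ m) f \<longleftrightarrow>
    act g f - f \<in> power_ideal (CARD('p) ^ m)"
proof
  let ?q = "CARD('p) ^ m"
  note ideal = mod_ring_power_ideal_alg_hom[OF alg_hom_act homogeneous_act_Var]
  have f: "f \<in> residue_class ?q f" by (simp add: in_residue_class_iff power_ideal_0)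
  show "act g f - f \<in> power_ideal ?q" if "act g ` residue_class ?q f = residue_class ?q f"
    using imageI[OF f, of "act g"] that by (simp add: in_residue_class_iff)
  assume *: "act g f - f \<in> power_ideal ?q"
  show "act g ` residue_class ?q f = residue_class ?q f"
  proof (intro equalityI subsetI)
    fix y assume "y \<in> act g ` residue_class ?q f"
    then obtain x where "y = act g x" "x - f \<in> power_ideal ?q" by (auto simp: in_residue_class_iff)
    then have "y - act g f \<in> power_ideal ?q"
      using ideal[of "x - f" m g] by (simp add: alg_hom_diff[OF alg_hom_act])
    then show "y \<in> residue_class ?q f"
      using * by (simp add: in_residue_class_iff power_ideal_diff_trans)
  next
    fix y assume "y \<in> residue_class ?q f"
    then have "y - f \<in> power_ideal ?q" by (simp add: in_residue_class_iff)
    with * have "y - act g f \<in> power_ideal ?q"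
      by (meson power_ideal_diff_commute power_ideal_diff_trans)
    then have "act (matrix_inv g) y - act (matrix_inv g) (act g f) \<in> power_ideal ?q"
      using ideal[of "y - act g f" m "matrix_inv g"] by (simp add: alg_hom_diff[OF alg_hom_act])
    moreover have "act (matrix_inv g) (act g f) = f"
    proof -
      have "invertible (matrix_inv g)" "matrix_inv (matrix_inv g) = g"
        using matrix_inv[OF assms] by (auto simp: invertible_def intro: matrix_inv_unique)
      then show ?thesis using act_matrix_inv[of "matrix_inv g" f] by simp
    qed
    ultimately have "act (matrix_inv g) y \<in> residue_class ?q f" by (simp add: in_residue_class_iff)
    then show "y \<in> act g ` residue_class ?q f"
      by (rule image_eqI[rotated]) (simp add: act_matrix_inv[OF assms])
  qed
qed

lemma quot_invariants_Int_quot_degree: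
  fixes G :: "('p::prime_card mod_ring ^ 'n ^ 'n) set"
  assumes "\<And>g. g \<in> G \<Longrightarrow> invertible g"
  shows "quot_invariants (CARD('p) ^ m) G \<inter> quot_degree (CARD('p) ^ m) d =
    residue_class (CARD('p) ^ m) ` {f \<in> homogeneous d. \<forall>g\<in>G. act g f - f \<in> power_ideal (CARD('p) ^ m)}"
proof -
  let ?q = "CARD('p) ^ m"
  have inv: "residue_class ?q f \<in> quot_invariants ?q G \<longleftrightarrow> (\<forall>g\<in>G. act g f - f \<in> power_ideal ?q)" for f
    unfolding quot_invariants_def carrier_quot_ring using assms by (simp add: act_residue_class_eq_iff)
  show ?thesis
  proof (intro equalityI subsetI)
    fix C assume C: "C \<in> quot_invariants ?q G \<inter> quot_degree ?q d"
    then obtain f where "f \<in> homogeneous d" "C = residue_class ?q f"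
      unfolding quot_degree_def by blast
    with C inv[of f] show "C \<in> residue_class ?q ` {f \<in> homogeneous d. \<forall>g\<in>G. act g f - f \<in> power_ideal ?q}"
      by (intro image_eqI[of _ _ f]) simp_all
  next
    fix C assume "C \<in> residue_class ?q ` {f \<in> homogeneous d. \<forall>g\<in>G. act g f - f \<in> power_ideal ?q}"
    then obtain f where "f \<in> homogeneous d" "\<forall>g\<in>G. act g f - f \<in> power_ideal ?q" "C = residue_class ?q f"
      by blast
    with inv[of f] show "C \<in> quot_invariants ?q G \<inter> quot_degree ?q d"
      unfolding quot_degree_def by simp
  qed
qed

lemma shear_cong:
  "(\<And>i. i \<noteq> i0 \<Longrightarrow> \<alpha> i = \<beta> i) \<Longrightarrow> shear i0 \<alpha> \<zeta> = shear i0 \<beta> \<zeta>"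
  unfolding shear_def by (intro arg_cong[of _ _ subst] ext) auto

text \<open>Two kinds of roots give the forward direction: those in the kernel that act as
  elementary transvections, and multiples of \<open>axis i0 1\<close>, which act as scalings. The
  converse is checked on single basis polynomials.\<close>

lemma invariant_iff_coefficients:
  fixes i0 :: "'n::finite" and R :: "('p::prime_card mod_ring ^ 'n) set" and l q d
    and c :: "('n \<Rightarrow> nat) \<Rightarrow> 'p mod_ring"
  defines "f \<equiv> \<Sum>\<mu>\<in>exponents q d. Const (c \<mu>) * basis_poly i0 \<mu>"
  assumes lin: "Vector_Spaces.linear (*s) (*) l" and i0: "l (axis i0 1) \<noteq> 0"
    and kernel: "{v. l v = 0} \<subseteq> R"
    and add: "\<And>\<alpha> \<beta>. \<alpha> \<in> R \<Longrightarrow> l \<beta> = 0 \<Longrightarrow> \<alpha> + \<beta> \<in> R"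
    and nonzero: "\<And>\<alpha>. \<alpha> \<in> R \<Longrightarrow> 1 + l \<alpha> \<noteq> 0"
    and e: "\<And>k. e dvd k \<longleftrightarrow> (\<forall>\<alpha>\<in>R. (1 + l \<alpha>) ^ k = 1)" and "e dvd q - 1" "0 < q"
  shows "(\<forall>\<alpha>\<in>R. shear i0 (($) \<alpha>) (1 + l \<alpha>) f - f \<in> power_ideal q) \<longleftrightarrow>
    (\<forall>\<mu>\<in>exponents q d. c \<mu> \<noteq> 0 \<longrightarrow> \<mu> \<in> invariant_exponents i0 CARD('p) e q d)"
proof
  interpret l: Vector_Spaces.linear "(*s)" "(*)" l by (rule lin)
  assume inv: "\<forall>\<alpha>\<in>R. shear i0 (($) \<alpha>) (1 + l \<alpha>) f - f \<in> power_ideal q"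
  show "\<forall>\<mu>\<in>exponents q d. c \<mu> \<noteq> 0 \<longrightarrow> \<mu> \<in> invariant_exponents i0 CARD('p) e q d"
  proof (intro ballI impI)
    fix \<mu> :: "'n \<Rightarrow> nat" assume \<mu>: "\<mu> \<in> exponents q d" "c \<mu> \<noteq> 0"
    have "CARD('p) dvd \<mu> k" if "k \<noteq> i0" "Suc (\<mu> i0) < q" for k
    proof (rule ccontr)
      assume "\<not> CARD('p) dvd \<mu> k"
      \<comment> \<open>The correction along \<open>axis i0 1\<close> makes l vanish without
        touching the other coordinates, which alone enter the shear.\<close>
      let ?\<alpha> = "axis k 1 - (l (axis k 1) / l (axis i0 1)) *s axis i0 1"
      have l0: "l ?\<alpha> = 0" using i0 by (simp add: l.diff l.scale)
      then have "shear i0 (($) ?\<alpha>) 1 f - f \<in> power_ideal q"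
        using inv kernel by fastforce
      also have "shear i0 (($) ?\<alpha>) 1 = shear i0 (\<lambda>i. if i = k then 1 else 0) 1"
        by (rule shear_cong) (simp add: axis_def)
      finally have "c \<mu> = 0"
        unfolding f_def by (rule transvection_invariant_coefficients[OF that(1) _ \<mu>(1) \<open>\<not> CARD('p) dvd \<mu> k\<close> that(2)])
      with \<mu>(2) show False ..
    qed
    moreover have "e dvd \<mu> i0"
      unfolding e
    proof
      fix \<alpha> assume \<alpha>: "\<alpha> \<in> R"
      \<comment> \<open>This vector has the same value under l as \<open>\<alpha>\<close>, hence
        differs from it by a root in the kernel; its coordinates off \<open>i0\<close> are
        0.\<close>
      let ?\<beta> = "(l \<alpha> / l (axis i0 1)) *s axis i0 1"
      have l\<beta>: "l ?\<beta> = l \<alpha>" using i0 by (simp add: l.scale)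
      have "\<alpha> + (?\<beta> - \<alpha>) \<in> R" using l\<beta> by (intro add[OF \<alpha>]) (simp only: l.diff diff_self)
      then have "?\<beta> \<in> R" by simp
      with inv l\<beta> have "shear i0 (($) ?\<beta>) (1 + l \<alpha>) f - f \<in> power_ideal q" by metis
      also have "shear i0 (($) ?\<beta>) (1 + l \<alpha>) = shear i0 (\<lambda>_. 0) (1 + l \<alpha>)"
        by (rule shear_cong) (simp add: axis_def)
      finally show "(1 + l \<alpha>) ^ \<mu> i0 = 1"
        unfolding f_def by (rule scaling_invariant_coefficients[where c = c, OF nonzero[OF \<alpha>] _ \<mu>])
    qed
    moreover have "\<mu> i0 < q" using \<mu>(1) by (simp add: exponents_def)
    then have "\<mu> i0 = q - 1 \<or> Suc (\<mu> i0) < q" by linarith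
    ultimately show "\<mu> \<in> invariant_exponents i0 CARD('p) e q d"
      using \<mu>(1) by (auto simp: invariant_exponents_def)
  qed
next
  assume supp: "\<forall>\<mu>\<in>exponents q d. c \<mu> \<noteq> 0 \<longrightarrow> \<mu> \<in> invariant_exponents i0 CARD('p) e q d"
  show "\<forall>\<alpha>\<in>R. shear i0 (($) \<alpha>) (1 + l \<alpha>) f - f \<in> power_ideal q"
  proof
    fix \<alpha> assume \<alpha>: "\<alpha> \<in> R"
    have pow: "(1 + l \<alpha>) ^ k = 1" if "e dvd k" for k using that \<alpha> unfolding e by blast
    have "shear i0 (($) \<alpha>) (1 + l \<alpha>) f - f =
        (\<Sum>\<mu>\<in>exponents q d. Const (c \<mu>) * (shear i0 (($) \<alpha>) (1 + l \<alpha>) (basis_poly i0 \<mu>) - basis_poly i0 \<mu>))"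
      unfolding f_def by (simp add: alg_hom_simps[OF alg_hom_shear] sum_subtractf right_diff_distrib)
    also have "\<dots> \<in> power_ideal q"
    proof (rule power_ideal_sum)
      fix \<mu> :: "'n \<Rightarrow> nat" assume \<mu>: "\<mu> \<in> exponents q d"
      show "Const (c \<mu>) * (shear i0 (($) \<alpha>) (1 + l \<alpha>) (basis_poly i0 \<mu>) - basis_poly i0 \<mu>) \<in> power_ideal q"
      proof (cases "c \<mu> = 0")
        case False
        with supp \<mu> have "\<mu> i0 = q - 1 \<or> (\<forall>i. i \<noteq> i0 \<longrightarrow> CARD('p) dvd \<mu> i) \<and> e dvd \<mu> i0"
          by (auto simp: invariant_exponents_def)
        then have "shear i0 (($) \<alpha>) (1 + l \<alpha>) (basis_poly i0 \<mu>) - basis_poly i0 \<mu> \<in> power_ideal q"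
        proof
          \<comment> \<open>Here \<open>e dvd q - 1\<close> supplies
            \<open>(1 + l \<alpha>) ^ \<mu> i0 = 1\<close>.\<close>
          assume "\<mu> i0 = q - 1"
          then show ?thesis
            using nonzero[OF \<alpha>] pow assms(8,9) by (intro shear_basis_poly_invariant_top) simp_all
        next
          assume "(\<forall>i. i \<noteq> i0 \<longrightarrow> CARD('p) dvd \<mu> i) \<and> e dvd \<mu> i0"
          then show ?thesis
            using nonzero[OF \<alpha>] pow by (simp add: shear_basis_poly_invariant power_ideal_0)
        qed
        then show ?thesis by (rule power_ideal_mult)
      qed (simp add: power_ideal_0)
    qed
    finally show "shear i0 (($) \<alpha>) (1 + l \<alpha>) f - f \<in> power_ideal q" .
  qed
qed

section \<open>Coordinates in which l is a variable\<close>

definition linear_form :: "('a::field ^ 'n \<Rightarrow> 'a) \<Rightarrow> ('n::finite, 'a) mpoly" where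
  "linear_form l = (\<Sum>j\<in>UNIV. Const (l (axis j 1)) * Var j)"

text \<open>Translates from adapted to original coordinates: before the substitution the variable
  \<open>i0\<close> stands for the form l.\<close>

definition adapt :: "('a::field ^ 'n \<Rightarrow> 'a) \<Rightarrow> 'n::finite \<Rightarrow> ('n, 'a) mpoly \<Rightarrow> ('n, 'a) mpoly" where
  "adapt l i0 = subst (\<lambda>i. if i = i0 then linear_form l else Var i)"

text \<open>Solves the form l for the variable \<open>i0\<close>; this inverts \<open>adapt\<close>
  when \<open>l (axis i0 1) \<noteq> 0\<close>.\<close>

definition unadapt :: "('a::field ^ 'n \<Rightarrow> 'a) \<Rightarrow> 'n::finite \<Rightarrow> ('n, 'a) mpoly \<Rightarrow> ('n, 'a) mpoly" where
  "unadapt l i0 = subst (\<lambda>i. if i = i0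
     then Const (inverse (l (axis i0 1))) * (Var i0 - (\<Sum>j\<in>-{i0}. Const (l (axis j 1)) * Var j)) else Var i)"

lemma alg_hom_adapt: "alg_hom (adapt l i0)" and alg_hom_unadapt: "alg_hom (unadapt l i0)"
  by (simp_all add: adapt_def unadapt_def alg_hom_subst)

lemma homogeneous_linear_form: "linear_form l \<in> homogeneous 1"
  unfolding linear_form_def by (intro homogeneous_sum homogeneous_Const_mult homogeneous_Var)

lemma homogeneous_adapt_Var: "adapt l i0 (Var i) \<in> homogeneous 1"
  by (simp add: adapt_def subst_Var homogeneous_linear_form homogeneous_Var del: One_nat_def)

lemma homogeneous_unadapt_Var: "unadapt l i0 (Var i) \<in> homogeneous 1"
  unfolding unadapt_def subst_Var
  by (auto intro!: homogeneous_sum homogeneous_Const_mult homogeneous_Var homogeneous_diff simp del: One_nat_def)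

lemma linear_form_remove:
  "linear_form l = Const (l (axis i0 1)) * Var i0 + (\<Sum>j\<in>-{i0}. Const (l (axis j 1)) * Var j)"
  unfolding linear_form_def by (simp add: sum.remove[of UNIV i0] Compl_eq_Diff_UNIV)

lemma Const_inverse_mult: "c \<noteq> 0 \<Longrightarrow> Const (inverse c) * (Const c * f) = f" for c :: "'a::field"
  by (simp flip: mult.assoc Const_mult)

lemma adapt_unadapt:
  assumes "l (axis i0 1) \<noteq> 0"
  shows "adapt l i0 (unadapt l i0 f) = f"
proof (rule alg_hom_eqI[OF alg_hom_comp[OF alg_hom_adapt alg_hom_unadapt] alg_hom_id])
  fix i
  have "(\<Sum>j\<in>-{i0}. Const (l (axis j 1)) * adapt l i0 (Var j)) = (\<Sum>j\<in>-{i0}. Const (l (axis j 1)) * Var j)"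
    by (rule sum.cong) (simp_all add: adapt_def subst_Var)
  then have "adapt l i0 (unadapt l i0 (Var i0)) = Const (inverse (l (axis i0 1))) *
      (linear_form l - (\<Sum>j\<in>-{i0}. Const (l (axis j 1)) * Var j))"
    by (simp add: unadapt_def subst_Var alg_hom_simps[OF alg_hom_adapt]) (simp add: adapt_def subst_Var)
  also have "\<dots> = Var i0"
    using assms by (simp add: linear_form_remove[of l i0] Const_inverse_mult)
  finally show "adapt l i0 (unadapt l i0 (Var i)) = Var i"
    by (cases "i = i0") (simp_all add: adapt_def unadapt_def subst_Var)
qed

lemma unadapt_adapt:
  assumes "l (axis i0 1) \<noteq> 0"
  shows "unadapt l i0 (adapt l i0 f) = f"
proof (rule alg_hom_eqI[OF alg_hom_comp[OF alg_hom_unadapt alg_hom_adapt] alg_hom_id])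
  fix i
  let ?S = "\<Sum>j\<in>-{i0}. Const (l (axis j 1)) * Var j"
  have "(\<Sum>j\<in>-{i0}. Const (l (axis j 1)) * unadapt l i0 (Var j)) = ?S"
    by (rule sum.cong) (simp_all add: unadapt_def subst_Var)
  then have "unadapt l i0 (linear_form l) = Const (l (axis i0 1)) * (Const (inverse (l (axis i0 1))) * (Var i0 - ?S)) + ?S"
    unfolding linear_form_remove[of l i0]
    by (simp add: alg_hom_simps[OF alg_hom_unadapt]) (simp add: unadapt_def subst_Var)
  also have "\<dots> = Var i0"
    using assms by (simp add: Const_inverse_mult mult.left_commute[of "Const (l (axis i0 1))"])
  finally show "unadapt l i0 (adapt l i0 (Var i)) = Var i"
    by (cases "i = i0") (simp_all add: adapt_def unadapt_def subst_Var)
qed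

text \<open>The action substitutes by the inverse matrix, so the root of that inverse appears. It
  sends \<open>Var k\<close> to \<open>Var k + Const (\<alpha> $ k) * linear_form l\<close> and the
  form itself to \<open>1 + l \<alpha>\<close> times itself, which is the shear with l in place of
  \<open>Var i0\<close>.\<close>

lemma act_adapt:
  fixes g :: "'a::field ^ 'n ^ 'n"
  assumes lin: "Vector_Spaces.linear (*s) (*) l" and g: "\<forall>v. matrix_inv g *v v = v + l v *s \<alpha>"
  shows "act g (adapt l i0 f) = adapt l i0 (shear i0 (($) \<alpha>) (1 + l \<alpha>) f)"
proof (rule alg_hom_eqI[OF alg_hom_comp[OF alg_hom_act alg_hom_adapt] alg_hom_comp[OF alg_hom_adapt alg_hom_shear]])
  interpret l: Vector_Spaces.linear "(*s)" "(*)" l by (rule lin)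
  fix i
  have entry: "matrix_inv g $ k $ j = (if j = k then 1 else 0) + l (axis j 1) * \<alpha> $ k" for k j
  proof -
    have "matrix_inv g $ k $ j = (matrix_inv g *v axis j 1) $ k"
      by (simp add: matrix_vector_mult_def axis_def if_distrib[of "(*) _"] cong: if_cong)
    then show ?thesis using g by (simp add: axis_def)
  qed
  have act_Var: "act g (Var k) = Var k + Const (\<alpha> $ k) * linear_form l" for k
  proof -
    have "act g (Var k) = (\<Sum>j\<in>UNIV. (if j = k then Var j else 0) + Const (\<alpha> $ k) * (Const (l (axis j 1)) * Var j))"
      unfolding act_eq_subst subst_Var
      by (rule sum.cong) (auto simp: entry Const_add Const_mult algebra_simps)
    then show ?thesis by (simp add: sum.distrib linear_form_def sum_distrib_left)
  qed
  have "l \<alpha> = l (\<Sum>j\<in>UNIV. \<alpha> $ j *s axis j 1)" by (simp only: basis_expansion)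
  then have l\<alpha>: "l \<alpha> = (\<Sum>j\<in>UNIV. l (axis j 1) * \<alpha> $ j)"
    by (simp add: l.sum l.scale mult.commute)
  have "act g (linear_form l) = (\<Sum>j\<in>UNIV. Const (l (axis j 1)) * act g (Var j))"
    by (simp add: linear_form_def alg_hom_simps[OF alg_hom_act])
  also have "\<dots> = (\<Sum>j\<in>UNIV. Const (l (axis j 1)) * Var j + Const (l (axis j 1) * \<alpha> $ j) * linear_form l)"
    by (rule sum.cong) (simp_all add: act_Var Const_mult distrib_left mult.assoc)
  also have "\<dots> = linear_form l + (\<Sum>j\<in>UNIV. Const (l (axis j 1) * \<alpha> $ j)) * linear_form l"
    by (simp only: sum.distrib linear_form_def[symmetric] sum_distrib_right)
  finally have act_l: "act g (linear_form l) = Const (1 + l \<alpha>) * linear_form l"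
    by (simp only: l\<alpha> Const_add Const_sum Const_simps distrib_right mult_1_left)
  show "act g (adapt l i0 (Var i)) = adapt l i0 (shear i0 (($) \<alpha>) (1 + l \<alpha>) (Var i))"
    by (cases "i = i0") (simp_all add: shear_Var alg_hom_simps[OF alg_hom_adapt], simp_all add: adapt_def subst_Var act_l act_Var)
qed

section \<open>A basis of the invariants and the Hilbert series\<close>

lemma quot_invariants_basis:
  fixes l :: "'p::prime_card mod_ring ^ 'n \<Rightarrow> 'p mod_ring" and i0 :: 'n and m d :: nat
  defines "q \<equiv> CARD('p) ^ m"
  assumes "hyperplane_group l G" and i0: "l (axis i0 1) \<noteq> 0"
    and kernel: "{v. l v = 0} \<subseteq> root_space l G"
    and e: "\<And>k. e dvd k \<longleftrightarrow> (\<forall>\<alpha>\<in>root_space l G. (1 + l \<alpha>) ^ k = 1)" and "e dvd q - 1"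
  shows "quot_invariants q G \<inter> quot_degree q d = range (\<lambda>c. residue_class q
    (\<Sum>\<mu>\<in>invariant_exponents i0 CARD('p) e q d. Const (c \<mu>) * adapt l i0 (basis_poly i0 \<mu>)))"
    (is "_ = range ?span")
proof -
  interpret hyperplane_group l G by fact
  let ?E = "exponents q d :: ('n \<Rightarrow> nat) set" and ?B = "invariant_exponents i0 CARD('p) e q d"
  let ?P = "\<lambda>c. \<Sum>\<mu>\<in>?E. Const (c \<mu>) * basis_poly i0 \<mu> :: ('n, 'p mod_ring) mpoly"
  have invertible: "invertible g" if "g \<in> G" for g
    using subgroup.subset[OF subgroup_G] that by auto
  have inv_in: "matrix_inv g \<in> G" if "g \<in> G" for g
  proof -
    have "inv\<^bsub>GL\<^esub> g \<in> G" using that by (rule subgroup.m_inv_closed[OF subgroup_G])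
    moreover have "inv\<^bsub>GL\<^esub> g = matrix_inv g"
      using group.r_inv[OF group_GL, of g] group.l_inv[OF group_GL, of g] invertible[OF that]
      by (intro matrix_inv_unique[symmetric]) simp_all
    ultimately show ?thesis by simp
  qed
  have adapt_ideal: "adapt l i0 f \<in> power_ideal q \<longleftrightarrow> f \<in> power_ideal q" for f
    using mod_ring_power_ideal_alg_hom[OF alg_hom_adapt homogeneous_adapt_Var, of f m l i0]
      mod_ring_power_ideal_alg_hom[OF alg_hom_unadapt homogeneous_unadapt_Var, of "adapt l i0 f" m l i0]
    by (auto simp: q_def unadapt_adapt[of l i0, OF i0])
  \<comment> \<open>Inversion permutes G, so running over all group elements is the same as running
    over all roots of their inverses.\<close>
  have act_adapt_iff: "(\<forall>g\<in>G. act g (adapt l i0 f) - adapt l i0 f \<in> power_ideal q) \<longleftrightarrow>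
      (\<forall>\<alpha>\<in>R. shear i0 (($) \<alpha>) (1 + l \<alpha>) f - f \<in> power_ideal q)" for f
  proof (intro iffI ballI)
    fix \<alpha> assume inv: "\<forall>g\<in>G. act g (adapt l i0 f) - adapt l i0 f \<in> power_ideal q" and "\<alpha> \<in> R"
    then obtain h where h: "h \<in> G" "\<forall>v. h *v v = v + l v *s \<alpha>" by (elim rootE)
    have "matrix_inv (matrix_inv h) = h"
      using matrix_inv[OF invertible[OF h(1)]] by (intro matrix_inv_unique)
    then have "act (matrix_inv h) (adapt l i0 f) = adapt l i0 (shear i0 (($) \<alpha>) (1 + l \<alpha>) f)"
      using h(2) by (intro act_adapt[OF l.linear_axioms]) simp
    with inv inv_in[OF h(1)] have "adapt l i0 (shear i0 (($) \<alpha>) (1 + l \<alpha>) f) - adapt l i0 f \<in> power_ideal q"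
      by metis
    then show "shear i0 (($) \<alpha>) (1 + l \<alpha>) f - f \<in> power_ideal q"
      by (simp add: adapt_ideal flip: alg_hom_diff[OF alg_hom_adapt])
  next
    fix g assume inv: "\<forall>\<alpha>\<in>R. shear i0 (($) \<alpha>) (1 + l \<alpha>) f - f \<in> power_ideal q" and "g \<in> G"
    then obtain \<alpha> where \<alpha>: "\<alpha> \<in> R" "\<forall>v. matrix_inv g *v v = v + l v *s \<alpha>"
      using root_exists[OF inv_in] by metis
    have "act g (adapt l i0 f) = adapt l i0 (shear i0 (($) \<alpha>) (1 + l \<alpha>) f)"
      using \<alpha>(2) by (rule act_adapt[OF l.linear_axioms])
    with inv \<alpha>(1) show "act g (adapt l i0 f) - adapt l i0 f \<in> power_ideal q"
      by (simp add: adapt_ideal flip: alg_hom_diff[OF alg_hom_adapt])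
  qed
  have inv_iff: "(\<forall>g\<in>G. act g (adapt l i0 (?P c)) - adapt l i0 (?P c) \<in> power_ideal q) \<longleftrightarrow>
      (\<forall>\<mu>\<in>?E. c \<mu> \<noteq> 0 \<longrightarrow> \<mu> \<in> ?B)" for c
    unfolding act_adapt_iff
  proof (rule invariant_iff_coefficients[OF l.linear_axioms i0 kernel _ root_eigenvalue_nonzero e \<open>e dvd q - 1\<close>])
    show "\<alpha> + \<beta> \<in> R" if "\<alpha> \<in> R" "l \<beta> = 0" for \<alpha> \<beta>
      using that kernel by (intro root_add) auto
    show "0 < q" by (simp add: q_def)
  qed
  have span: "?span c = residue_class q (adapt l i0 (?P c))" if "\<forall>\<mu>\<in>?E. c \<mu> \<noteq> 0 \<longrightarrow> \<mu> \<in> ?B" for c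
  proof -
    have "?P c = (\<Sum>\<mu>\<in>?B. Const (c \<mu>) * basis_poly i0 \<mu>)"
      using that by (intro sum.mono_neutral_right) (auto simp: finite_exponents invariant_exponents_def)
    then show ?thesis by (simp add: alg_hom_simps[OF alg_hom_adapt])
  qed
  have "quot_invariants q G \<inter> quot_degree q d =
      residue_class q ` {f \<in> homogeneous d. \<forall>g\<in>G. act g f - f \<in> power_ideal q}"
    unfolding q_def by (rule quot_invariants_Int_quot_degree) (rule invertible)
  also have "\<dots> = range ?span"
  proof (intro equalityI subsetI)
    fix C assume "C \<in> residue_class q ` {f \<in> homogeneous d. \<forall>g\<in>G. act g f - f \<in> power_ideal q}"
    then obtain f where f: "f \<in> homogeneous d" "\<forall>g\<in>G. act g f - f \<in> power_ideal q" and C: "C = residue_class q f"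
      by blast
    have "unadapt l i0 f \<in> homogeneous d"
      by (rule homogeneous_alg_hom[OF alg_hom_unadapt homogeneous_unadapt_Var f(1)])
    then obtain c where "unadapt l i0 f - ?P c \<in> power_ideal q"
      by (rule basis_poly_spans)
    then have "adapt l i0 (unadapt l i0 f - ?P c) \<in> power_ideal q" by (simp only: adapt_ideal)
    then have diff: "f - adapt l i0 (?P c) \<in> power_ideal q"
      by (simp add: alg_hom_diff[OF alg_hom_adapt] adapt_unadapt[of l i0, OF i0])
    \<comment> \<open>Invariance modulo the ideal passes from f to any polynomial congruent to it,
      because the ideal is stable under g.\<close>
    have "act g (adapt l i0 (?P c)) - adapt l i0 (?P c) \<in> power_ideal q" if "g \<in> G" for g
    proof -
      have "act g (f - adapt l i0 (?P c)) \<in> power_ideal q"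
        using diff unfolding q_def by (rule mod_ring_power_ideal_alg_hom[OF alg_hom_act homogeneous_act_Var])
      then have "act g (adapt l i0 (?P c)) - act g f \<in> power_ideal q"
        by (subst power_ideal_diff_commute) (simp only: alg_hom_diff[OF alg_hom_act])
      then show ?thesis using f(2) that diff by (meson power_ideal_diff_trans)
    qed
    then have "?span c = residue_class q (adapt l i0 (?P c))" using inv_iff by (intro span) blast
    also have "\<dots> = C" unfolding C using diff by (simp only: residue_class_eq_iff power_ideal_diff_commute)
    finally show "C \<in> range ?span" by (intro range_eqI[where x = c]) simp
  next
    fix C assume "C \<in> range ?span"
    then obtain c where C: "C = ?span c" by blast
    \<comment> \<open>Cutting the coefficients off outside \<open>?B\<close> leaves the residue
      class unchanged and makes the criterion \<open>inv_iff\<close> applicable.\<close>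
    define c' where "c' \<mu> = (if \<mu> \<in> ?B then c \<mu> else 0)" for \<mu>
    have supp: "\<forall>\<mu>\<in>?E. c' \<mu> \<noteq> 0 \<longrightarrow> \<mu> \<in> ?B" by (simp add: c'_def)
    have "?span c = ?span c'"
      by (intro arg_cong[of _ _ "residue_class q"] sum.cong) (simp_all add: c'_def)
    then have "C = residue_class q (adapt l i0 (?P c'))" using span[OF supp] C by simp
    moreover have "?P c' \<in> homogeneous d"
      by (intro homogeneous_sum homogeneous_Const_mult) (auto simp: exponents_def intro: homogeneous_basis_poly)
    then have "adapt l i0 (?P c') \<in> homogeneous d"
      by (rule homogeneous_alg_hom[OF alg_hom_adapt homogeneous_adapt_Var])
    moreover have "\<forall>g\<in>G. act g (adapt l i0 (?P c')) - adapt l i0 (?P c') \<in> power_ideal q"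
      using supp inv_iff by blast
    ultimately show "C \<in> residue_class q ` {f \<in> homogeneous d. \<forall>g\<in>G. act g f - f \<in> power_ideal q}"
      by (intro image_eqI[of _ _ "adapt l i0 (?P c')"]) simp_all
  qed
  finally show ?thesis .
qed

text \<open>Independence of the basis polynomials survives the coordinate change because
  \<open>unadapt\<close> maps the ideal into itself.\<close>

lemma hilb_quot_invariants:
  fixes l :: "'p::prime_card mod_ring ^ 'n \<Rightarrow> 'p mod_ring" and i0 :: 'n and m :: nat
  defines "q \<equiv> CARD('p) ^ m"
  assumes "hyperplane_group l G" and i0: "l (axis i0 1) \<noteq> 0"
    and kernel: "{v. l v = 0} \<subseteq> root_space l G"
    and e: "\<And>k. e dvd k \<longleftrightarrow> (\<forall>\<alpha>\<in>root_space l G. (1 + l \<alpha>) ^ k = 1)" and "e dvd q - 1"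
  shows "hilb q (quot_invariants q G) = Abs_fps (\<lambda>d. of_nat (card (invariant_exponents i0 CARD('p) e q d)))"
proof -
  have "ring.dim (quot_ring q) (range (\<lambda>c. residue_class q (Const c))) (quot_invariants q G \<inter> quot_degree q d) =
      card (invariant_exponents i0 CARD('p) e q d)" for d
    unfolding q_def quot_invariants_basis[OF assms(2-6)[unfolded q_def]]
  proof (rule dim_residue_class_span)
    let ?B = "invariant_exponents i0 CARD('p) e (CARD('p) ^ m) d"
    have sub: "?B \<subseteq> exponents (CARD('p) ^ m) d" by (auto simp: invariant_exponents_def)
    then show "finite ?B" using finite_exponents finite_subset by blast
    show "\<forall>\<mu>\<in>?B. c \<mu> = 0"
      if *: "(\<Sum>\<mu>\<in>?B. Const (c \<mu>) * adapt l i0 (basis_poly i0 \<mu>)) \<in> power_ideal (CARD('p) ^ m)" for c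
    proof
      fix \<mu> assume "\<mu> \<in> ?B"
      have "adapt l i0 (\<Sum>\<mu>\<in>?B. Const (c \<mu>) * basis_poly i0 \<mu>) \<in> power_ideal (CARD('p) ^ m)"
        using * by (simp add: alg_hom_simps[OF alg_hom_adapt])
      then have "unadapt l i0 (adapt l i0 (\<Sum>\<mu>\<in>?B. Const (c \<mu>) * basis_poly i0 \<mu>)) \<in> power_ideal (CARD('p) ^ m)"
        by (rule mod_ring_power_ideal_alg_hom[OF alg_hom_unadapt homogeneous_unadapt_Var])
      then have "(\<Sum>\<mu>\<in>?B. Const (c \<mu>) * basis_poly i0 \<mu>) \<in> power_ideal (CARD('p) ^ m)"
        by (simp only: unadapt_adapt[of l i0, OF i0])
      then show "c \<mu> = 0" using \<open>\<mu> \<in> ?B\<close> by (rule basis_poly_independent[where c = c, OF sub])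
    qed
  qed simp
  then show ?thesis unfolding hilb_def by (simp only:)
qed

theorem theorem7p2:
  fixes G :: "('p::prime_card mod_ring ^ 'n ^ 'n) set"
    and H :: "('p mod_ring ^ 'n) set"
    and l :: "'p mod_ring ^ 'n \<Rightarrow> 'p mod_ring"
    and p n m e :: nat
  assumes "p = CARD('p)" and "n = CARD('n)" and "m \<ge> 1"
    and "subgroup G GL"
    and "vec.subspace H" and "vec.dim H = n - 1"
    and "\<forall>g\<in>G. \<forall>v\<in>H. g *v v = v"
    and "Vector_Spaces.linear (*s) (*) l" and "{v. l v = 0} = H"
    and "vec.dim (root_space l G \<inter> H) = n - 1"
    and "e = Max (group.ord GL ` {g \<in> G. semisimple g})"
  shows "hilb (p ^ m) (quot_invariants (p ^ m) G) =
           ((1 - fps_X ^ (p ^ m)) / (1 - fps_X ^ p)) ^ (n - 1) *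
             ((1 - fps_X ^ (p ^ m - 1)) / (1 - fps_X ^ e)) +
           fps_X ^ (p ^ m - 1) * ((1 - fps_X ^ (p ^ m)) / (1 - fps_X)) ^ (n - 1)"
proof -
  interpret l: Vector_Spaces.linear "(*s)" "(*)" l by fact
  have "H \<noteq> UNIV"
  proof
    assume "H = UNIV"
    then have "CARD('n) = CARD('n) - 1" using assms(2,6) vec_dim_card by metis
    moreover have "CARD('n) > 0" by simp
    ultimately show False by linarith
  qed
  then obtain u where u: "l u \<noteq> 0" using assms(9) by blast
  \<comment> \<open>A nonzero linear form is nonzero on some coordinate vector; the corresponding
    variable is the one to be replaced by l.\<close>
  obtain i0 where i0: "l (axis i0 1) \<noteq> 0"
  proof (rule ccontr)
    assume "\<not> thesis"
    with that have "l (axis j 1) = 0" for j by blast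
    then have "l (\<Sum>j\<in>UNIV. u $ j *s axis j 1) = 0" by (simp add: l.sum l.scale)
    with u show False by (simp only: basis_expansion)
  qed
  have hg: "hyperplane_group l G"
    using assms(4,7-9) u by (intro hyperplane_group.intro hyperplane_group_axioms.intro) blast+
  have kernel: "{v. l v = 0} \<subseteq> root_space l G"
    using assms by (intro kernel_subset_root_space hg) simp
  note e = max_semisimple_order_dvd_iff[OF hg assms(11)]
  have p: "1 < p" unfolding assms(1) by (rule prime_card_gt_1)
  have "e dvd p ^ m - 1"
    unfolding e
  proof
    fix \<alpha> assume "\<alpha> \<in> root_space l G"
    then have nz: "1 + l \<alpha> \<noteq> 0" by (rule hyperplane_group.root_eigenvalue_nonzero[OF hg])
    \<comment> \<open>Raising to the power \<open>p ^ m\<close> fixes the prime field, and one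
      nonzero factor cancels.\<close>
    have "(1 + l \<alpha>) * (1 + l \<alpha>) ^ (p ^ m - 1) = (1 + l \<alpha>) ^ (p ^ m)"
      using p by (simp flip: power_Suc)
    also have "\<dots> = 1 + l \<alpha>" unfolding assms(1) by (rule mod_ring_power_card_pow)
    finally show "(1 + l \<alpha>) ^ (p ^ m - 1) = 1" using nz by simp
  qed
  moreover have "1 < p ^ m" using p assms(3) by (intro one_less_power) simp_all
  \<comment> \<open>If e were 0, its divisibility would force \<open>p ^ m - 1 = 0\<close>.\<close>
  moreover from calculation have "0 < e" by (intro gr0I) simp
  moreover have "p dvd p ^ m" using assms(3) by (simp add: dvd_power)
  ultimately show ?thesis
    using hilb_quot_invariants[OF hg i0 kernel e, of m] p
      invariant_exponents_generating_function[of "p ^ m" p e i0, where 'k = rat]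
    unfolding assms(1,2) by simp
qed

end
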